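(* Let $n\ge3$ be an integer and let $\alpha\in(0,\tfrac1n)\cup(\tfrac1n,\tfrac1{n-1})$. Let $|\mathcal X|=n$, $p_{Y|X}=\mathcal H_{n,\alpha}$ and $p_X=\mathcal U_n$ (uniform on $\mathcal X$). Then for all $R\in[0,\log n]$, $$\mathrm{IB}(R,\mathcal U_n,\mathcal H_{n,\alpha})=\begin{cases}\dfrac{\varphi(R_c)}{R_c}\,R, & R\in[0,R_c],\\[2mm] \varphi(R), & R\in(R_c,\log n],\end{cases}$$ where $\varphi(R)=\varphi(R,\mathcal H_{n,\alpha})$ and $R_c$ is the unique real number in $(0,\log n)$ satisfying $\frac{d\varphi}{dR}(R_c)=\frac{\varphi(R_c)}{R_c}$.
   Context: All random variables take values in finite alphabets; $\log$ is to a fixed base greater than $1$; $H$ denotes Shannon entropy and $I$ mutual information. Hamming channel: for $\mathcal X=\mathcal Y$ with $|\mathcal X|=n\ge2$ and $\alpha\in[0,\frac1{n-1}]$, the channel $\mathcal H_{n,\alpha}$ is $p_{Y|X}(y|x)=1-(n-1)\alpha$ if $x=y$, and $p_{Y|X}(y|x)=\alpha$ if $x\ne y$. Information bottleneck function: given $p_X$ and $p_{Y|X}$, for $R\in[0,H(X)]$, $$\mathrm{IB}(R,p_X,p_{Y|X})=\max_{p_{T|X}:\ Y-X-T,\ I(X;T)\le R} I(Y;T),$$ where the maximum is over all channels $p_{T|X}$ from $\mathcal X$ to an arbitrary finite alphabet $\mathcal T$, and $Y-X-T$ means that $Y,X,T$ form a Markov chain in that order. For $R\in[0,\log n]$, $$\varphi(R)=\varphi(R,\mathcal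 H_{n,\alpha})=\max_{p_X:\ \log n-H(X)\le R}\big(\log n-H(Y)\big),$$ where the maximum is over all distributions $p_X$ on the $n$-element alphabet $\mathcal X$ (not only the uniform one) and $Y$ is the output of $\mathcal H_{n,\alpha}$ with input $X\sim p_X$. *)

theory Defs
  imports "HOL-Probability.Probability"
begin

definition pmf_entropy :: "real \<Rightarrow> 'a pmf \<Rightarrow> real" where
  "pmf_entropy b p = prob_space.entropy (measure_pmf p) b (count_space UNIV) (\<lambda>x. x)"

definition pmf_mutual_information ::
    "real \<Rightarrow> 'w pmf \<Rightarrow> ('w \<Rightarrow> 'a) \<Rightarrow> ('w \<Rightarrow> 'b) \<Rightarrow> real" where
  "pmf_mutual_information b Q X Y =
     prob_space.mutual_information (measure_pmf Q) b (count_space UNIV) (count_space UNIV) X Y"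

text \<open>
  A channel from \<^typ>\<open>'a\<close> to \<^typ>\<open>'b\<close> is a function \<^typ>\<open>'a \<Rightarrow> 'b pmf\<close>. The Hamming channel
  is meaningful only for \<open>0 \<le> \<alpha>\<close> and \<open>(n - 1) * \<alpha> \<le> 1\<close>, where \<open>n = CARD('a)\<close>: outside this range
  \<^const>\<open>embed_pmf\<close> is unspecified.
\<close>

definition hamming_channel :: "real \<Rightarrow> 'a::finite \<Rightarrow> 'a pmf" where
  "hamming_channel \<alpha> x =
     embed_pmf (\<lambda>y. if x = y then 1 - (real CARD('a) - 1) * \<alpha> else \<alpha>)"

text \<open>
  The joint law of \<open>(Y, X, T)\<close> in which \<open>X\<close> has law \<open>p\<close> and, given \<open>X\<close>, the variables \<open>Y\<close> and
  \<open>T\<close> are drawn independently from the channels \<open>W\<close> and \<open>V\<close>; this is exactly the Markov chain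
  condition \<open>Y - X - T\<close>.
\<close>

definition markov_joint ::
    "'x pmf \<Rightarrow> ('x \<Rightarrow> 'y pmf) \<Rightarrow> ('x \<Rightarrow> 't pmf) \<Rightarrow> ('y \<times> 'x \<times> 't) pmf" where
  "markov_joint p W V =
     bind_pmf p (\<lambda>x. bind_pmf (W x) (\<lambda>y. bind_pmf (V x) (\<lambda>t. return_pmf (y, x, t))))"

text \<open>
  An arbitrary finite alphabet for \<open>T\<close> is represented by a finite set \<open>A\<close> of natural numbers; its
  elements are mere labels, so this is no restriction.

  Maxima are expressed by \<^const>\<open>Greatest\<close> rather than by \<^const>\<open>Sup\<close>, so that the value is
  specified only if it is attained.
\<close>

definition IB :: "real \<Rightarrow> real \<Rightarrow> 'x::finite pmf \<Rightarrow> ('x \<Rightarrow> 'y::finite pmf) \<Rightarrow> real" where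
  "IB b R p W =
     (GREATEST v. \<exists>(A :: nat set) (V :: 'x \<Rightarrow> nat pmf).
        finite A \<and> (\<forall>x. set_pmf (V x) \<subseteq> A) \<and>
        pmf_mutual_information b (markov_joint p W V) (\<lambda>(y, x, t). x) (\<lambda>(y, x, t). t) \<le> R \<and>
        v = pmf_mutual_information b (markov_joint p W V) (\<lambda>(y, x, t). y) (\<lambda>(y, x, t). t))"

definition phi :: "real \<Rightarrow> ('x::finite \<Rightarrow> 'x pmf) \<Rightarrow> real \<Rightarrow> real" where
  "phi b W R =
     (GREATEST v. \<exists>p :: 'x pmf.
        log b (real CARD('x)) - pmf_entropy b p \<le> R \<and>
        v = log b (real CARD('x)) - pmf_entropy b (bind_pmf p W))"

definition critical_rate :: "real \<Rightarrow> ('x::finite \<Rightarrow> 'x pmf) \<Rightarrow> real \<Rightarrow> bool" where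
  "critical_rate b W Rc \<longleftrightarrow>
     Rc \<in> {0<..<log b (real CARD('x))} \<and>
     (phi b W has_real_derivative phi b W Rc / Rc) (at Rc)"

lemma pmf_hamming_channel:
  fixes x y :: "'a::finite"
  assumes "0 \<le> \<alpha>" "(real CARD('a) - 1) * \<alpha> \<le> 1"
  shows "pmf (hamming_channel \<alpha> x) y =
           (if x = y then 1 - (real CARD('a) - 1) * \<alpha> else \<alpha>)"
proof -
  define f where "f = (\<lambda>y. if x = y then 1 - (real CARD('a) - 1) * \<alpha> else \<alpha>)"
  have nn: "0 \<le> f y" for y
    using assms by (auto simp: f_def)
  have "sum f UNIV = f x + sum f (UNIV - {x})"
    by (rule sum.remove) auto
  also have "sum f (UNIV - {x}) = (\<Sum>y\<in>UNIV - {x}. \<alpha>)"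
    by (rule sum.cong) (auto simp: f_def)
  also have "\<dots> = (real CARD('a) - 1) * \<alpha>"
    by (simp add: card_Diff_singleton of_nat_diff Suc_leI)
  finally have "sum f UNIV = 1"
    by (simp add: f_def)
  then have "(\<integral>\<^sup>+y. ennreal (f y) \<partial>count_space UNIV) = 1"
    using nn by (simp add: nn_integral_count_space_finite sum_ennreal)
  then have "pmf (embed_pmf f) y = f y"
    using nn by (intro pmf_embed_pmf) auto
  then show ?thesis
    by (simp add: hamming_channel_def f_def)
qed

lemma distributed_map_pmf:
  "distributed (measure_pmf Q) (count_space UNIV) Z (pmf (map_pmf Z Q))"
  by (auto simp: distributed_def simp flip: map_pmf_rep_eq intro: measure_pmf_eq_density)

lemma pmf_entropy_eq:
  fixes p :: "'a::finite pmf"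
  assumes "1 < b"
  shows "pmf_entropy b p = - (\<Sum>x\<in>UNIV. pmf p x * log b (pmf p x))"
proof -
  interpret information_space "measure_pmf p" b
    by standard (fact assms)
  have "distributed (measure_pmf p) (count_space UNIV) (\<lambda>x. x) (pmf p)"
    using distributed_map_pmf[of p "\<lambda>x. x"] by simp
  from entropy_distr[OF this] show ?thesis
    by (simp add: pmf_entropy_def lebesgue_integral_count_space_finite)
qed

lemma pmf_mutual_information_eq:
  fixes Q :: "'w pmf" and X :: "'w \<Rightarrow> 'a::countable" and Y :: "'w \<Rightarrow> 'b::countable"
  assumes b: "1 < b" and fin: "finite (set_pmf Q)"
  shows "pmf_mutual_information b Q X Y =
    (\<Sum>(x, y)\<in>(\<lambda>w. (X w, Y w)) ` set_pmf Q.
       pmf (map_pmf (\<lambda>w. (X w, Y w)) Q) (x, y) *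
       log b (pmf (map_pmf (\<lambda>w. (X w, Y w)) Q) (x, y) /
              (pmf (map_pmf X Q) x * pmf (map_pmf Y Q) y)))"
proof -
  interpret information_space "measure_pmf Q" b
    by standard (fact b)
  have pair: "count_space UNIV \<Otimes>\<^sub>M count_space UNIV = (count_space UNIV :: ('a \<times> 'b) measure)"
    by (simp add: pair_measure_countable)
  define J where "J = map_pmf (\<lambda>w. (X w, Y w)) Q"
  define f where "f = (\<lambda>z. pmf J z * log b (pmf J z / (pmf (map_pmf X Q) (fst z) * pmf (map_pmf Y Q) (snd z))))"
  have "distributed (measure_pmf Q) (count_space UNIV \<Otimes>\<^sub>M count_space UNIV) (\<lambda>w. (X w, Y w)) (pmf J)"
    unfolding pair J_def by (rule distributed_map_pmf)
  from mutual_information_distr[OF sigma_finite_measure_count_space sigma_finite_measure_count_space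
      distributed_map_pmf _ distributed_map_pmf _ this]
  have "pmf_mutual_information b Q X Y = (\<integral>z. f z \<partial>count_space UNIV)"
    by (simp add: pmf_mutual_information_def pair f_def)
  also have "\<dots> = (\<Sum>z | z \<in> UNIV \<and> f z \<noteq> 0. f z)"
    by (rule lebesgue_integral_count_space_finite_support)
       (rule finite_subset[OF _ finite_imageI[OF fin, of "\<lambda>w. (X w, Y w)"]],
        auto simp: f_def J_def pmf_eq_0_set_pmf)
  also have "\<dots> = (\<Sum>z\<in>(\<lambda>w. (X w, Y w)) ` set_pmf Q. f z)"
    by (rule sum.mono_neutral_left) (auto simp: fin f_def J_def pmf_eq_0_set_pmf)
  finally show ?thesis
    by (simp add: case_prod_unfold f_def J_def)
qed

end

theory Submission
  imports Defs "HOL-Real_Asymp.Real_Asymp"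
begin

text \<open>
  Write \<open>n = m + 1\<close> and \<open>\<beta> = 1 - n * \<alpha>\<close>, so that the channel maps \<open>p\<close> to
  \<open>(1 - \<beta>) * uniform + \<beta> * p\<close>, and let \<open>D u\<close> be the divergence from the uniform law of
  \<open>u * \<delta> + (1 - u) * uniform\<close>, in nats. Two facts determine everything.

  Among the inputs of divergence at most \<open>D u\<close>, the two-point law above has the output of largest
  divergence, so \<open>\<phi> (D u) = D (\<beta> * u)\<close>. Indeed \<open>\<beta> * ln (1 - \<beta> + \<beta> * exp s)\<close> is convex and
  increasing in \<open>s\<close> for either sign of \<open>\<beta>\<close>, which yields a Lagrangian, separable over the symbols,
  whose value at an arbitrary input is bounded by its value at the two-point law. Its multiplier
  comes from the chord between the small atom \<open>1 - u\<close> of the two-point law and the largest atom of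
  the input (both multiplied by \<open>n\<close>).

  The derivative of \<open>\<phi>\<close> at \<open>D u\<close> is \<open>\<beta> * L (\<beta> * u) / L u\<close> with
  \<open>L u = ln ((1 + m * u) / (1 - u))\<close>. Up to a positive factor its derivative in \<open>u\<close> is
  \<open>E u = \<beta>\<^sup>2 * B u - \<beta> * B (\<beta> * u)\<close> with \<open>B = P * L\<close> and \<open>P u = (1 + m * u) * (1 - u)\<close>. As
  \<open>B''' = - n^3 / P\<^sup>2\<close>, the third derivative of \<open>E\<close> is negative, so \<open>E\<close> is first positive and then
  negative: \<open>\<phi>\<close> is first convex and then concave. Hence exactly one tangent at an inner point passes
  through the origin, and together with \<open>\<phi>\<close> beyond its point of contact it forms the concave
  envelope of \<open>\<phi>\<close>.

  Since the uniform input is an average of permutations of any law, the information bottleneck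
  function is this concave envelope.
\<close>

subsection \<open>The function \<open>x ln x\<close>\<close>

definition xlnx :: "real \<Rightarrow> real" where
  "xlnx x = x * ln x"

lemma xlnx_0 [simp]: "xlnx 0 = 0" and xlnx_1 [simp]: "xlnx 1 = 0"
  by (simp_all add: xlnx_def)

lemma DERIV_xlnx [derivative_intros]:
  assumes "(f has_real_derivative D) (at x within S)" "0 < f x"
  shows "((\<lambda>x. xlnx (f x)) has_real_derivative (1 + ln (f x)) * D) (at x within S)"
  unfolding xlnx_def using assms
  by (auto intro!: derivative_eq_intros simp: field_simps)

lemma continuous_on_xlnx: "continuous_on {0..} xlnx"
proof -
  have "continuous (at x within {0..}) xlnx" if "0 \<le> x" for x
  proof (cases "x = 0")
    case True
    have "((\<lambda>x::real. x * ln x) \<longlongrightarrow> 0) (at_right 0)"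
      by real_asymp
    then show ?thesis
      using True by (simp add: continuous_within xlnx_def[abs_def] at_within_Ici_at_right)
  next
    case False
    with that have "isCont xlnx x"
      using DERIV_xlnx[OF DERIV_ident, of x UNIV] by (auto intro: DERIV_isCont)
    then show ?thesis
      by (rule continuous_at_imp_continuous_at_within)
  qed
  then show ?thesis
    by (simp add: continuous_on_eq_continuous_within)
qed

lemma continuous_on_xlnx' [continuous_intros]:
  assumes "continuous_on S f" "\<And>x. x \<in> S \<Longrightarrow> 0 \<le> f x"
  shows "continuous_on S (\<lambda>x. xlnx (f x))"
  by (rule continuous_on_compose2[OF continuous_on_xlnx assms(1)]) (use assms(2) in auto)

lemma xlnx_ge_tangent:
  assumes "0 \<le> x" "0 < y"
  shows "xlnx y + (1 + ln y) * (x - y) \<le> xlnx x"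
proof (cases "x = 0")
  case True
  then show ?thesis
    using assms by (simp add: xlnx_def algebra_simps)
next
  case False
  with assms have x: "0 < x" by simp
  have "ln (y / x) \<le> y / x - 1"
    using x assms(2) by (intro ln_le_minus_one) simp
  then have "x * (ln y - ln x) \<le> x * (y / x - 1)"
    using x assms(2) by (intro mult_left_mono) (auto simp: ln_div)
  then show ?thesis
    using x by (simp add: xlnx_def algebra_simps)
qed

lemma xlnx_le_chord:
  assumes "0 \<le> s" "s \<le> 1" "0 < x" "0 < y"
  shows "xlnx ((1 - s) * x + s * y) \<le> (1 - s) * xlnx x + s * xlnx y"
proof -
  define z where "z = (1 - s) * x + s * y"
  have z: "0 < z"
    unfolding z_def using assms
    by (cases "s = 0") (auto intro!: add_nonneg_pos)
  have "(1 - s) * (xlnx z + (1 + ln z) * (x - z)) \<le> (1 - s) * xlnx x"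
       "s * (xlnx z + (1 + ln z) * (y - z)) \<le> s * xlnx y"
    using assms z by (auto intro!: mult_left_mono xlnx_ge_tangent)
  moreover have "(1 - s) * (xlnx z + (1 + ln z) * (x - z)) + s * (xlnx z + (1 + ln z) * (y - z))
      = xlnx z + (1 + ln z) * ((1 - s) * x + s * y - z)"
    by (simp add: algebra_simps)
  ultimately show ?thesis
    by (simp add: z_def)
qed

subsection \<open>Sign changes of the second derivative of \<open>\<phi>\<close>\<close>

lemma strictly_neg_after:
  fixes F F' :: "real \<Rightarrow> real"
  assumes "F 0 = 0"
    and cont: "continuous_on {0..<1} F"
    and deriv: "\<And>u. 0 < u \<Longrightarrow> u < 1 \<Longrightarrow> (F has_real_derivative F' u) (at u)"
    and F': "\<And>u v. 0 < u \<Longrightarrow> u < v \<Longrightarrow> v < 1 \<Longrightarrow> F' u \<le> 0 \<Longrightarrow> F' v < 0"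
    and u: "0 < u" "u < v" "v < 1" "F u \<le> 0"
  shows "F v < 0"
proof -
  obtain \<xi> where \<xi>: "0 < \<xi>" "\<xi> < u" "F u - F 0 = (u - 0) * F' \<xi>"
  proof -
    have "\<exists>l z. 0 < z \<and> z < u \<and> DERIV F z :> l \<and> F u - F 0 = (u - 0) * l"
      using u by (intro MVT continuous_on_subset[OF cont])
        (auto simp: real_differentiable_def intro!: exI deriv)
    then show ?thesis
      using that deriv u by (metis DERIV_unique less_trans)
  qed
  with u assms(1) have "F' \<xi> \<le> 0"
    by (metis diff_zero mult_pos_pos not_le)
  have "F v < F u"
  proof (rule DERIV_neg_imp_decreasing_open[where f = F])
    show "\<exists>y. DERIV F w :> y \<and> y < 0" if "u < w" "w < v" for w
      using F'[of \<xi> w] deriv[of w] \<open>F' \<xi> \<le> 0\<close> \<xi> u that by auto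
    show "continuous_on {u..v} F"
      by (rule continuous_on_subset[OF cont]) (use u in auto)
  qed (fact u)
  with u show ?thesis by simp
qed

locale symmetric_channel =
  fixes m \<beta> :: real
  assumes m_gt_1: "1 < m"
    and \<beta>_nz: "\<beta> \<noteq> 0" and \<beta>_gt: "-1 < m * \<beta>" and \<beta>_less: "\<beta> < 1"
begin

definition L :: "real \<Rightarrow> real" where
  "L u = ln (1 + m * u) - ln (1 - u)"

definition D :: "real \<Rightarrow> real" where
  "D u = (xlnx (1 + m * u) + m * xlnx (1 - u)) / (m + 1)"

definition P :: "real \<Rightarrow> real" where
  "P u = (1 + m * u) * (1 - u)"

lemma DERIV_L:
  assumes "-1 < m * u" "u < 1"
  shows "(L has_real_derivative (m + 1) / P u) (at u)"
  unfolding L_def[abs_def] P_def using assms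
  by (auto intro!: derivative_eq_intros simp: field_simps)

lemma DERIV_D:
  assumes "-1 < m * u" "u < 1"
  shows "(D has_real_derivative m / (m + 1) * L u) (at u)"
proof -
  have "m + 1 \<noteq> 0" using m_gt_1 by simp
  then show ?thesis
    unfolding D_def[abs_def] L_def using assms
    by (auto intro!: derivative_eq_intros simp: divide_simps) (simp add: algebra_simps)
qed

lemma scaled_range:
  assumes "0 \<le> u" "u \<le> 1"
  shows "-1 < m * (\<beta> * u)" "\<beta> * u < 1"
proof -
  show "\<beta> * u < 1"
  proof (cases "0 \<le> \<beta>")
    case True
    then have "\<beta> * u \<le> \<beta>" using assms by (intro mult_left_le) auto
    then show ?thesis using \<beta>_less by linarith
  next
    case False
    then have "\<beta> * u \<le> 0" using assms by (intro mult_nonpos_nonneg) auto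
    then show ?thesis by linarith
  qed
  have "-1 < (m * \<beta>) * u"
  proof (cases "0 \<le> m * \<beta>")
    case True
    then have "0 \<le> (m * \<beta>) * u" using assms by simp
    then show ?thesis by linarith
  next
    case False
    then have "(m * \<beta>) * 1 \<le> (m * \<beta>) * u"
      using assms by (intro mult_left_mono_neg) auto
    then show ?thesis using \<beta>_gt by linarith
  qed
  then show "-1 < m * (\<beta> * u)" by (simp add: mult.assoc)
qed

lemma unscaled_range:
  assumes "0 \<le> u" shows "-1 < m * u"
  using assms m_gt_1 mult_nonneg_nonneg[of m u] by linarith

lemma P_pos: "-1 < m * u \<Longrightarrow> u < 1 \<Longrightarrow> 0 < P u"
  by (simp add: P_def)

lemma P_scaled_gt:
  assumes "0 < u" "u < 1"
  shows "\<bar>\<beta>\<bar> * P u < P (\<beta> * u)"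
proof (cases "0 < \<beta>")
  case True
  have "P (\<beta> * u) - \<beta> * P u = (1 - \<beta>) * (1 + m * \<beta> * u\<^sup>2)"
    by (simp add: P_def algebra_simps power2_eq_square)
  moreover have "0 < (1 - \<beta>) * (1 + m * \<beta> * u\<^sup>2)"
    using True \<beta>_less m_gt_1 by (intro mult_pos_pos add_pos_nonneg) auto
  ultimately show ?thesis using True by simp
next
  case False
  define \<gamma> where "\<gamma> = - \<beta>"
  have \<gamma>: "0 < \<gamma>" "m * \<gamma> < 1" "\<gamma> < 1"
  proof -
    show "0 < \<gamma>" "m * \<gamma> < 1" using False \<beta>_nz \<beta>_gt by (auto simp: \<gamma>_def)
    then show "\<gamma> < 1" using m_gt_1 mult_strict_right_mono[of 1 m \<gamma>] by linarith
  qed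
  have a: "m * \<gamma> * u < u" using \<gamma> assms by simp
  have b: "\<gamma> * (1 - u) < 1 * (1 - u)" using \<gamma> assms by (intro mult_strict_right_mono) auto
  have "(1 - u) * (\<gamma> * (1 + m * u)) < (1 - m * \<gamma> * u) * (1 + \<gamma> * u)"
  proof (rule mult_strict_mono)
    show "1 - u < 1 - m * \<gamma> * u" using a by simp
    show "\<gamma> * (1 + m * u) < 1 + \<gamma> * u" using a b by (simp add: algebra_simps)
    show "0 < 1 - m * \<gamma> * u" using a assms by linarith
    show "0 \<le> \<gamma> * (1 + m * u)" using \<gamma> assms m_gt_1 by simp
  qed
  then show ?thesis
    using False by (simp add: P_def \<gamma>_def algebra_simps)
qed

definition E :: "real \<Rightarrow> real" where
  "E u = \<beta>\<^sup>2 * (P u * L u) - \<beta> * (P (\<beta> * u) * L (\<beta> * u))"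

definition E1 :: "real \<Rightarrow> real" where
  "E1 u = \<beta>\<^sup>2 * (L u * (m - 1 - 2 * m * u) - L (\<beta> * u) * (m - 1 - 2 * m * (\<beta> * u)))"

definition E2 :: "real \<Rightarrow> real" where
  "E2 u = \<beta>\<^sup>2 * (((m + 1) * (m - 1 - 2 * m * u) / P u - 2 * m * L u) -
     \<beta> * ((m + 1) * (m - 1 - 2 * m * (\<beta> * u)) / P (\<beta> * u) - 2 * m * L (\<beta> * u)))"

lemma DERIV_P: "(P has_real_derivative m - 1 - 2 * m * u) (at u)"
  unfolding P_def[abs_def] by (auto intro!: derivative_eq_intros simp: algebra_simps)

lemma DERIV_PL:
  assumes "-1 < m * u" "u < 1"
  shows "((\<lambda>u. P u * L u) has_real_derivative m + 1 + L u * (m - 1 - 2 * m * u)) (at u)"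
  by (rule DERIV_cong[OF DERIV_mult[OF DERIV_P DERIV_L[OF assms]]])
     (use P_pos[OF assms] in simp)

lemma DERIV_PL1:
  assumes "-1 < m * u" "u < 1"
  shows "((\<lambda>u. L u * (m - 1 - 2 * m * u)) has_real_derivative
    (m + 1) * (m - 1 - 2 * m * u) / P u - 2 * m * L u) (at u)"
  by (auto intro!: derivative_eq_intros DERIV_L assms)

lemma DERIV_PL2:
  assumes "-1 < m * u" "u < 1"
  shows "((\<lambda>u. (m + 1) * (m - 1 - 2 * m * u) / P u - 2 * m * L u) has_real_derivative
    - ((m + 1) ^ 3) / (P u)\<^sup>2) (at u)"
proof -
  have "(m + 1) * ((- 2 * m) * P u - (m - 1 - 2 * m * u) * (m - 1 - 2 * m * u)) / (P u * P u)
     - 2 * m * ((m + 1) / P u)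
     = - (m + 1) * (4 * m * P u + (m - 1 - 2 * m * u)\<^sup>2) / (P u)\<^sup>2"
    using P_pos[OF assms] by (simp add: field_simps power2_eq_square)
  also have "4 * m * P u + (m - 1 - 2 * m * u)\<^sup>2 = (m + 1)\<^sup>2"
    by (simp add: P_def power2_eq_square algebra_simps)
  finally have eq: "(m + 1) * ((- 2 * m) * P u - (m - 1 - 2 * m * u) * (m - 1 - 2 * m * u)) / (P u * P u)
     - 2 * m * ((m + 1) / P u) = - ((m + 1) ^ 3) / (P u)\<^sup>2"
    by (simp add: power2_eq_square power3_eq_cube algebra_simps)
  show ?thesis
    unfolding eq[symmetric] using P_pos[OF assms]
    by (intro DERIV_diff DERIV_cmult DERIV_L assms)
       (auto intro!: derivative_eq_intros DERIV_P simp: algebra_simps)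
qed

lemma DERIV_scaled:
  assumes "\<And>v. -1 < m * v \<Longrightarrow> v < 1 \<Longrightarrow> (f has_real_derivative f' v) (at v)"
    and "0 \<le> u" "u \<le> 1"
  shows "((\<lambda>u. f (\<beta> * u)) has_real_derivative f' (\<beta> * u) * \<beta>) (at u)"
  by (rule DERIV_chain2[of f]) (use assms scaled_range in \<open>auto intro!: derivative_eq_intros\<close>)

lemma DERIV_E:
  assumes "0 \<le> u" "u < 1"
  shows "(E has_real_derivative E1 u) (at u)"
  unfolding E_def[abs_def]
  by (rule DERIV_cong[OF DERIV_diff[OF
        DERIV_cmult[OF DERIV_PL[OF unscaled_range]]
        DERIV_cmult[OF DERIV_scaled[OF DERIV_PL]]]])
     (use assms in \<open>auto simp: E1_def algebra_simps power2_eq_square\<close>)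

lemma DERIV_E1:
  assumes "0 \<le> u" "u < 1"
  shows "(E1 has_real_derivative E2 u) (at u)"
  unfolding E1_def[abs_def]
  by (rule DERIV_cong[OF DERIV_cmult[OF DERIV_diff[OF
        DERIV_PL1[OF unscaled_range] DERIV_scaled[OF DERIV_PL1]]]])
     (use assms in \<open>auto simp: E2_def\<close>)

lemma DERIV_E2:
  assumes "0 \<le> u" "u < 1"
  shows "(E2 has_real_derivative
    - \<beta>\<^sup>2 * (m + 1) ^ 3 * (1 / (P u)\<^sup>2 - \<beta>\<^sup>2 / (P (\<beta> * u))\<^sup>2)) (at u)"
  unfolding E2_def[abs_def]
  by (rule DERIV_cong[OF DERIV_cmult[OF DERIV_diff[OF
        DERIV_PL2[OF unscaled_range] DERIV_cmult[OF DERIV_scaled[OF DERIV_PL2]]]]])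
     (use assms in \<open>auto simp: algebra_simps power2_eq_square diff_divide_distrib\<close>)

lemma E2_strict_antimono:
  assumes "0 < u" "u < v" "v < 1"
  shows "E2 v < E2 u"
proof (rule DERIV_neg_imp_decreasing[OF \<open>u < v\<close>], intro exI conjI)
  fix x assume x: "u \<le> x" "x \<le> v"
  then show "(E2 has_real_derivative
    - \<beta>\<^sup>2 * (m + 1) ^ 3 * (1 / (P x)\<^sup>2 - \<beta>\<^sup>2 / (P (\<beta> * x))\<^sup>2)) (at x)"
    using assms by (intro DERIV_E2) auto
  have P: "0 < P x" "0 < P (\<beta> * x)"
    using x assms scaled_range[of x] by (auto intro!: P_pos unscaled_range)
  have "(\<bar>\<beta>\<bar> * P x)\<^sup>2 < (P (\<beta> * x))\<^sup>2"
    using P_scaled_gt[of x] x assms P by (intro power_strict_mono) auto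
  then have "\<beta>\<^sup>2 / (P (\<beta> * x))\<^sup>2 < 1 / (P x)\<^sup>2"
    using P by (simp add: pos_divide_less_eq pos_less_divide_eq power_mult_distrib)
  then have "0 < 1 / (P x)\<^sup>2 - \<beta>\<^sup>2 / (P (\<beta> * x))\<^sup>2"
    by simp
  then have "0 < \<beta>\<^sup>2 * (m + 1) ^ 3 * (1 / (P x)\<^sup>2 - \<beta>\<^sup>2 / (P (\<beta> * x))\<^sup>2)"
    using m_gt_1 \<beta>_nz by (intro mult_pos_pos) auto
  then show "- \<beta>\<^sup>2 * (m + 1) ^ 3 * (1 / (P x)\<^sup>2 - \<beta>\<^sup>2 / (P (\<beta> * x))\<^sup>2) < 0"
    by simp
qed

lemma continuous_on_E: "continuous_on {0..<1} E"
  and continuous_on_E1: "continuous_on {0..<1} E1"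
  by (auto intro!: continuous_at_imp_continuous_on DERIV_isCont DERIV_E DERIV_E1)

lemma E1_neg_after:
  assumes "0 < u" "u < v" "v < 1" "E1 u \<le> 0"
  shows "E1 v < 0"
proof (rule strictly_neg_after[where F = E1 and F' = E2])
  show "E1 0 = 0" by (simp add: E1_def L_def)
  show "E2 v < 0" if "0 < u" "u < v" "v < 1" "E2 u \<le> 0" for u v
    using E2_strict_antimono[of u v] that by simp
qed (use assms continuous_on_E1 DERIV_E1 in auto)

lemma E_neg_after:
  assumes "0 < u" "u < v" "v < 1" "E u \<le> 0"
  shows "E v < 0"
proof (rule strictly_neg_after[where F = E and F' = E1])
  show "E 0 = 0" by (simp add: E_def L_def)
qed (use assms continuous_on_E DERIV_E E1_neg_after in auto)

lemma E_pos_near_0: "\<exists>\<epsilon>>0. \<epsilon> < 1 \<and> (\<forall>u. 0 < u \<longrightarrow> u \<le> \<epsilon> \<longrightarrow> 0 < E u)"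
proof -
  have "E2 0 = \<beta>\<^sup>2 * ((1 - \<beta>) * ((m + 1) * (m - 1)))"
    by (simp add: E2_def P_def L_def algebra_simps)
  then have "0 < E2 0"
    using m_gt_1 \<beta>_nz \<beta>_less by simp
  moreover have "isCont E2 0"
    by (rule DERIV_isCont[OF DERIV_E2]) auto
  ultimately have "eventually (\<lambda>u. 0 < E2 u) (at_right 0)"
    by (intro order_tendstoD(1)[of _ "E2 0"]) (auto simp: isCont_def filterlim_at_split)
  then obtain e where e: "0 < e" "\<And>u. 0 < u \<Longrightarrow> u < e \<Longrightarrow> 0 < E2 u"
    by (auto simp: eventually_at_right_field)
  define \<epsilon> where "\<epsilon> = min e 1 / 2"
  have \<epsilon>: "0 < \<epsilon>" "\<epsilon> < 1" "\<epsilon> < e" using e(1) by (auto simp: \<epsilon>_def)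
  have E1: "0 < E1 u" if u: "0 < u" "u \<le> \<epsilon>" for u
  proof -
    have "E1 0 < E1 u"
    proof (rule DERIV_pos_imp_increasing_open[where f = E1])
      show "\<exists>y. DERIV E1 x :> y \<and> 0 < y" if "0 < x" "x < u" for x
        using DERIV_E1[of x] e(2)[of x] that u \<epsilon> by auto
      show "continuous_on {0..u} E1"
        by (rule continuous_on_subset[OF continuous_on_E1]) (use u \<epsilon> in auto)
    qed (fact u)
    then show ?thesis by (simp add: E1_def L_def)
  qed
  have "0 < E u" if u: "0 < u" "u \<le> \<epsilon>" for u
  proof -
    have "E 0 < E u"
    proof (rule DERIV_pos_imp_increasing_open[where f = E])
      show "\<exists>y. DERIV E x :> y \<and> 0 < y" if "0 < x" "x < u" for x
        using DERIV_E[of x] E1[of x] that u \<epsilon> by auto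
      show "continuous_on {0..u} E"
        by (rule continuous_on_subset[OF continuous_on_E]) (use u \<epsilon> in auto)
    qed (fact u)
    then show ?thesis by (simp add: E_def L_def)
  qed
  with \<epsilon> show ?thesis by auto
qed

subsection \<open>The critical point and supporting lines\<close>

lemma L_pos: "0 < u \<Longrightarrow> u < 1 \<Longrightarrow> 0 < L u"
proof -
  assume u: "0 < u" "u < 1"
  then have "0 < m * u" using m_gt_1 by simp
  then show ?thesis using u by (simp add: L_def add_pos_pos)
qed

lemma L_scaled_pos:
  assumes "0 < u" "u \<le> 1"
  shows "0 < \<beta> * L (\<beta> * u)"
proof -
  have r: "-1 < m * (\<beta> * u)" "\<beta> * u < 1"
    using scaled_range assms by auto
  show ?thesis
  proof (cases "0 < \<beta>")
    case True
    then have "0 < L (\<beta> * u)"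
      using r assms by (intro L_pos) auto
    with True show ?thesis by simp
  next
    case False
    with \<beta>_nz have \<beta>: "\<beta> < 0" by simp
    then have "\<beta> * u < 0" using assms by (simp add: mult_neg_pos)
    moreover from this have "m * (\<beta> * u) < 0" using m_gt_1 by (simp add: mult_pos_neg)
    ultimately have "L (\<beta> * u) < 0"
      using r by (simp add: L_def)
    with \<beta> show ?thesis by (simp add: mult_neg_neg)
  qed
qed

lemma D_0 [simp]: "D 0 = 0"
  by (simp add: D_def)

lemma D_1: "D 1 = ln (m + 1)"
  using m_gt_1 by (simp add: D_def xlnx_def add.commute)

lemma continuous_on_D: "continuous_on {0..1} D"
  unfolding D_def[abs_def] using m_gt_1
  by (intro continuous_intros) auto

lemma DERIV_D_scaled:
  assumes "0 \<le> u" "u \<le> 1"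
  shows "((\<lambda>u. D (\<beta> * u)) has_real_derivative m / (m + 1) * (\<beta> * L (\<beta> * u))) (at u)"
  by (rule DERIV_cong[OF DERIV_scaled[OF DERIV_D]]) (use assms in auto)

lemma continuous_on_D_scaled: "continuous_on {0..1} (\<lambda>u. D (\<beta> * u))"
  by (auto intro!: continuous_at_imp_continuous_on DERIV_isCont DERIV_D_scaled)

lemma D_strict_mono:
  assumes "0 \<le> u" "u < v" "v \<le> 1"
  shows "D u < D v"
proof (rule DERIV_pos_imp_increasing_open[where f = D])
  show "\<exists>y. DERIV D x :> y \<and> 0 < y" if x: "u < x" "x < v" for x
  proof (intro exI conjI)
    show "DERIV D x :> m / (m + 1) * L x"
      using x assms by (intro DERIV_D unscaled_range) auto
    show "0 < m / (m + 1) * L x"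
      using x assms m_gt_1 by (intro mult_pos_pos L_pos) auto
  qed
  show "continuous_on {u..v} D"
    by (rule continuous_on_subset[OF continuous_on_D]) (use assms in auto)
qed (fact assms)

lemma D_mono: "0 \<le> u \<Longrightarrow> u \<le> v \<Longrightarrow> v \<le> 1 \<Longrightarrow> D u \<le> D v"
  using D_strict_mono[of u v] by (cases "u = v") auto

lemma D_pos: "0 < u \<Longrightarrow> u \<le> 1 \<Longrightarrow> 0 < D u"
  using D_strict_mono[of 0 u] by simp

lemma D_scaled_strict_mono:
  assumes "0 \<le> u" "u < v" "v \<le> 1"
  shows "D (\<beta> * u) < D (\<beta> * v)"
proof (rule DERIV_pos_imp_increasing_open[where f = "\<lambda>u. D (\<beta> * u)"])
  show "\<exists>y. DERIV (\<lambda>u. D (\<beta> * u)) x :> y \<and> 0 < y" if x: "u < x" "x < v" for x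
  proof (intro exI conjI)
    show "DERIV (\<lambda>u. D (\<beta> * u)) x :> m / (m + 1) * (\<beta> * L (\<beta> * x))"
      using x assms by (intro DERIV_D_scaled) auto
    show "0 < m / (m + 1) * (\<beta> * L (\<beta> * x))"
      using x assms m_gt_1 by (intro mult_pos_pos[of "m / (m + 1)"] L_scaled_pos) auto
  qed
  show "continuous_on {u..v} (\<lambda>u. D (\<beta> * u))"
    by (rule continuous_on_subset[OF continuous_on_D_scaled]) (use assms in auto)
qed (fact assms)

lemma D_scaled_mono: "0 \<le> u \<Longrightarrow> u \<le> v \<Longrightarrow> v \<le> 1 \<Longrightarrow> D (\<beta> * u) \<le> D (\<beta> * v)"
  using D_scaled_strict_mono[of u v] by (cases "u = v") auto

lemma D_scaled_pos: "0 < u \<Longrightarrow> u \<le> 1 \<Longrightarrow> 0 < D (\<beta> * u)"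
  using D_scaled_strict_mono[of 0 u] by simp

definition slope :: "real \<Rightarrow> real" where
  "slope u = \<beta> * L (\<beta> * u) / L u"

lemma slope_pos: "0 < u \<Longrightarrow> u < 1 \<Longrightarrow> 0 < slope u"
  unfolding slope_def by (intro divide_pos_pos L_pos L_scaled_pos) auto

lemma DERIV_slope:
  assumes "0 < u" "u < 1"
  shows "(slope has_real_derivative (m + 1) * E u / (P u * P (\<beta> * u) * (L u)\<^sup>2)) (at u)"
proof -
  have nz: "P u \<noteq> 0" "P (\<beta> * u) \<noteq> 0" "L u \<noteq> 0"
    using P_pos[of u] P_pos[of "\<beta> * u"] L_pos[of u] scaled_range[of u] unscaled_range[of u] assms
    by auto
  have "((\<lambda>u. \<beta> * L (\<beta> * u)) has_real_derivative \<beta> * ((m + 1) / P (\<beta> * u) * \<beta>)) (at u)"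
    by (intro DERIV_cmult DERIV_scaled DERIV_L) (use assms in auto)
  from DERIV_divide[OF this DERIV_L nz(3)]
  have "(slope has_real_derivative
      (\<beta> * ((m + 1) / P (\<beta> * u) * \<beta>) * L u - \<beta> * L (\<beta> * u) * ((m + 1) / P u)) / (L u * L u)) (at u)"
    unfolding slope_def[abs_def] using assms unscaled_range by simp
  then show ?thesis
    by (rule DERIV_cong) (use nz in \<open>simp add: E_def divide_simps power2_eq_square algebra_simps\<close>)
qed

lemma isCont_slope: "0 < u \<Longrightarrow> u < 1 \<Longrightarrow> isCont slope u"
  by (rule DERIV_isCont[OF DERIV_slope])

lemma slope_deriv_factor_pos:
  assumes "0 < u" "u < 1"
  shows "0 < (m + 1) / (P u * P (\<beta> * u) * (L u)\<^sup>2)"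
  using P_pos[of u] P_pos[of "\<beta> * u"] L_pos[of u] scaled_range[of u] unscaled_range[of u] assms m_gt_1
  by auto

lemma slope_strict_mono:
  assumes "0 < u" "u < v" "v < 1" "\<And>w. u < w \<Longrightarrow> w < v \<Longrightarrow> 0 < E w"
  shows "slope u < slope v"
proof (rule DERIV_pos_imp_increasing_open[where f = slope])
  show "\<exists>y. DERIV slope x :> y \<and> 0 < y" if x: "u < x" "x < v" for x
    using DERIV_slope[of x] mult_pos_pos[OF assms(4)[OF x] slope_deriv_factor_pos[of x]] x assms
    by (auto simp: mult.commute)
qed (use assms in \<open>auto intro!: continuous_at_imp_continuous_on isCont_slope\<close>)

lemma slope_strict_antimono:
  assumes "0 < u" "u < v" "v < 1" "\<And>w. u < w \<Longrightarrow> w < v \<Longrightarrow> E w < 0"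
  shows "slope v < slope u"
proof (rule DERIV_neg_imp_decreasing_open[where f = slope])
  show "\<exists>y. DERIV slope x :> y \<and> y < 0" if x: "u < x" "x < v" for x
    using DERIV_slope[of x] mult_neg_pos[OF assms(4)[OF x] slope_deriv_factor_pos[of x]] x assms
    by (auto simp: mult.commute)
qed (use assms in \<open>auto intro!: continuous_at_imp_continuous_on isCont_slope\<close>)

lemma DERIV_D_scaled':
  assumes "0 < u" "u < 1"
  shows "((\<lambda>u. D (\<beta> * u)) has_real_derivative slope u * (m / (m + 1) * L u)) (at u)"
  by (rule DERIV_cong[OF DERIV_D_scaled]) (use assms L_pos[of u] in \<open>auto simp: slope_def\<close>)

definition N :: "real \<Rightarrow> real" where
  "N u = slope u * D u - D (\<beta> * u)"

lemma DERIV_N: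
  assumes "0 < u" "u < 1"
  shows "(N has_real_derivative (m + 1) * E u / (P u * P (\<beta> * u) * (L u)\<^sup>2) * D u) (at u)"
  unfolding N_def[abs_def]
  by (rule DERIV_cong[OF DERIV_diff[OF DERIV_mult[OF DERIV_slope DERIV_D] DERIV_D_scaled']])
     (use assms unscaled_range in auto)

lemma mean_value:
  assumes "0 < u" "u < 1"
  obtains \<xi> where "0 < \<xi>" "\<xi> < u" "D (\<beta> * u) = slope \<xi> * D u"
proof -
  have "\<exists>c. 0 < c \<and> c < u \<and> (D u - D 0) * (slope c * (m / (m + 1) * L c))
      = (D (\<beta> * u) - D (\<beta> * 0)) * (m / (m + 1) * L c)"
  proof (rule GMVT'[where f = D and g = "\<lambda>u. D (\<beta> * u)"])
    fix z
    assume "0 \<le> z" "z \<le> u"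
    with assms show "isCont D z" "isCont (\<lambda>u. D (\<beta> * u)) z"
      by (auto intro!: DERIV_isCont[OF DERIV_D] DERIV_isCont[OF DERIV_D_scaled] unscaled_range)
  next
    fix z
    assume "0 < z" "z < u"
    with assms show "DERIV D z :> m / (m + 1) * L z"
      "DERIV (\<lambda>u. D (\<beta> * u)) z :> slope z * (m / (m + 1) * L z)"
      by (intro DERIV_D DERIV_D_scaled' unscaled_range; simp)+
  qed (fact assms)
  then obtain c where c: "0 < c" "c < u"
      "D u * (slope c * (m / (m + 1) * L c)) = D (\<beta> * u) * (m / (m + 1) * L c)"
    by auto
  have "0 < m / (m + 1) * L c"
    using c assms m_gt_1 by (intro mult_pos_pos L_pos) auto
  then have "m / (m + 1) * L c \<noteq> 0" by (rule less_imp_neq[symmetric])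
  moreover have "D (\<beta> * u) * (m / (m + 1) * L c) = (slope c * D u) * (m / (m + 1) * L c)"
    using c(3) by (simp only: ac_simps)
  ultimately have "D (\<beta> * u) = slope c * D u"
    by (rule mult_right_cancel[THEN iffD1])
  with c that show ?thesis by blast
qed

lemma E_neg_of_N_nonpos:
  assumes "0 < u" "u < 1" "N u \<le> 0" "u \<le> v" "v < 1"
  shows "E v < 0"
proof -
  obtain \<xi> where \<xi>: "0 < \<xi>" "\<xi> < u" "D (\<beta> * u) = slope \<xi> * D u"
    using mean_value assms by blast
  have "(slope u - slope \<xi>) * D u \<le> 0"
    using assms(3) \<xi> by (simp add: N_def algebra_simps)
  then have "slope u \<le> slope \<xi>"
    using D_pos[of u] assms by (simp add: mult_le_0_iff)
  then obtain \<eta> where \<eta>: "\<xi> < \<eta>" "\<eta> < u" "E \<eta> \<le> 0"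
    using slope_strict_mono[of \<xi> u] \<xi> assms by (meson not_le)
  show ?thesis
    using E_neg_after[of \<eta> v] \<eta> \<xi> assms by auto
qed

lemma N_neg_after:
  assumes "0 < u" "u < v" "v < 1" "N u \<le> 0"
  shows "N v < 0"
proof -
  have "N v < N u"
  proof (rule DERIV_neg_imp_decreasing[where f = N])
    show "\<exists>y. DERIV N x :> y \<and> y < 0" if x: "u \<le> x" "x \<le> v" for x
    proof (intro exI conjI)
      show "DERIV N x :> (m + 1) * E x / (P x * P (\<beta> * x) * (L x)\<^sup>2) * D x"
        using x assms by (intro DERIV_N) auto
      have "E x < 0" "0 < D x" "0 < (m + 1) / (P x * P (\<beta> * x) * (L x)\<^sup>2)"
        using E_neg_of_N_nonpos[of u x] D_pos[of x] slope_deriv_factor_pos[of x] assms x by auto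
      then have "((m + 1) / (P x * P (\<beta> * x) * (L x)\<^sup>2) * D x) * E x < 0"
        by (intro mult_pos_neg mult_pos_pos)
      then show "(m + 1) * E x / (P x * P (\<beta> * x) * (L x)\<^sup>2) * D x < 0"
        by (simp add: algebra_simps)
    qed
  qed (fact assms)
  with assms show ?thesis by simp
qed

lemma N_pos_near_0: "\<exists>u. 0 < u \<and> u < 1 \<and> 0 < N u"
proof -
  obtain u where u: "0 < u" "u < 1" "\<And>v. 0 < v \<Longrightarrow> v \<le> u \<Longrightarrow> 0 < E v"
    using E_pos_near_0 by blast
  obtain \<xi> where \<xi>: "0 < \<xi>" "\<xi> < u" "D (\<beta> * u) = slope \<xi> * D u"
    using mean_value u by blast
  have "slope \<xi> < slope u"
    using u \<xi> by (intro slope_strict_mono) auto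
  then have "slope \<xi> * D u < slope u * D u"
    using D_pos[of u] u by simp
  with u \<xi> show ?thesis
    by (intro exI[of _ u]) (simp add: N_def)
qed

lemma L_at_top: "filterlim L at_top (at_left 1)"
proof -
  have 1: "filterlim (\<lambda>u::real. - ln (1 - u)) at_top (at_left 1)"
    by real_asymp
  have 2: "((\<lambda>u. ln (1 + m * u)) \<longlongrightarrow> ln (1 + m * 1)) (at_left 1)"
    using m_gt_1 by (intro tendsto_intros) auto
  from filterlim_tendsto_add_at_top[OF 2 1] show ?thesis
    by (simp add: L_def[abs_def])
qed

lemma slope_tendsto_0: "(slope \<longlongrightarrow> 0) (at_left 1)"
proof -
  have "isCont (\<lambda>u. \<beta> * L (\<beta> * u)) 1"
    by (rule DERIV_isCont[OF DERIV_cmult[OF DERIV_scaled[OF DERIV_L]]]) auto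
  then have "((\<lambda>u. \<beta> * L (\<beta> * u)) \<longlongrightarrow> \<beta> * L (\<beta> * 1)) (at_left 1)"
    by (simp add: isCont_def filterlim_at_split)
  then show ?thesis
    unfolding slope_def[abs_def]
    by (rule tendsto_divide_0) (rule filterlim_at_top_imp_at_infinity[OF L_at_top])
qed

lemma N_neg_near_1: "\<exists>u. a < u \<and> u < 1 \<and> N u < 0" if "a < 1" for a
proof -
  have "(D \<longlongrightarrow> D 1) (at_left 1)" "((\<lambda>u. D (\<beta> * u)) \<longlongrightarrow> D (\<beta> * 1)) (at_left 1)"
    by (rule continuous_on_Icc_at_leftD[OF continuous_on_D] zero_less_one
          continuous_on_Icc_at_leftD[OF continuous_on_D_scaled])+
  then have "(N \<longlongrightarrow> 0 * D 1 - D (\<beta> * 1)) (at_left 1)"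
    unfolding N_def[abs_def] by (intro tendsto_intros slope_tendsto_0)
  moreover have "0 * D 1 - D (\<beta> * 1) < 0"
    using D_scaled_pos[of 1] by simp
  ultimately have "eventually (\<lambda>u. N u < 0) (at_left 1)"
    by (rule order_tendstoD(2))
  moreover have "eventually (\<lambda>u. a < u \<and> u < 1) (at_left 1)"
    using that by (auto simp: eventually_at_left_field)
  ultimately have "eventually (\<lambda>u. a < u \<and> u < 1 \<and> N u < 0) (at_left 1)"
    by eventually_elim auto
  then show ?thesis
    by (rule eventually_happens'[rotated]) simp
qed

lemma ex1_critical: "\<exists>!c. 0 < c \<and> c < 1 \<and> N c = 0"
proof -
  obtain u where u: "0 < u" "u < 1" "0 < N u" using N_pos_near_0 by blast
  obtain v where v: "u < v" "v < 1" "N v < 0" using N_neg_near_1[OF u(2)] by blast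
  have "\<exists>c\<ge>u. c \<le> v \<and> N c = 0"
    by (rule IVT2') (use u v in \<open>auto intro!: continuous_at_imp_continuous_on DERIV_isCont[OF DERIV_N]\<close>)
  then obtain c where "u \<le> c" "c \<le> v" "N c = 0" by blast
  then have "0 < c" "c < 1" "N c = 0"
    using u v by linarith+
  moreover have "c = c'" if "0 < c" "c < 1" "N c = 0" "0 < c'" "c' < 1" "N c' = 0" for c c'
    using N_neg_after[of c c'] N_neg_after[of c' c] that by (metis less_irrefl less_le_not_le linorder_neqE order_refl)
  ultimately show ?thesis by blast
qed

definition crit :: real where
  "crit = (THE c. 0 < c \<and> c < 1 \<and> N c = 0)"

lemma crit: "0 < crit" "crit < 1" "N crit = 0"
  using theI'[OF ex1_critical] by (auto simp: crit_def)

lemma slope_crit: "slope crit = D (\<beta> * crit) / D crit"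
  using crit D_pos[of crit] by (simp add: N_def field_simps)

lemma N_pos_before: "0 < u \<Longrightarrow> u < crit \<Longrightarrow> 0 < N u"
  using N_neg_after[of u crit] crit by force

lemma slope_antimono_after_crit:
  assumes "crit \<le> u" "u < v" "v < 1"
  shows "slope v < slope u"
  using assms crit E_neg_of_N_nonpos[of crit] by (intro slope_strict_antimono) auto

lemma DERIV_supporting:
  assumes "0 < v" "v < 1"
  shows "((\<lambda>v. D (\<beta> * v) - s * D v) has_real_derivative (slope v - s) * (m / (m + 1) * L v)) (at v)"
  by (rule DERIV_cong[OF DERIV_diff[OF DERIV_D_scaled' DERIV_cmult[OF DERIV_D]]])
     (use assms unscaled_range[of v] in \<open>auto simp: left_diff_distrib diff_divide_distrib\<close>)

lemma continuous_on_supporting: "continuous_on {0..1} (\<lambda>v. D (\<beta> * v) - s * D v)"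
  by (intro continuous_intros continuous_on_D continuous_on_D_scaled)

lemma supporting_right:
  assumes u: "crit \<le> u" "u < 1" and v: "crit \<le> v" "v \<le> 1"
  shows "D (\<beta> * v) - slope u * D v \<le> D (\<beta> * u) - slope u * D u"
proof (cases "u \<le> v")
  case True
  show ?thesis
  proof (rule DERIV_nonpos_imp_decreasing_open[where f = "\<lambda>v. D (\<beta> * v) - slope u * D v", OF True])
    show "\<exists>y. DERIV (\<lambda>v. D (\<beta> * v) - slope u * D v) x :> y \<and> y \<le> 0" if x: "u < x" "x < v" for x
    proof (intro exI conjI)
      show "DERIV (\<lambda>v. D (\<beta> * v) - slope u * D v) x :> (slope x - slope u) * (m / (m + 1) * L x)"
        using x u v crit by (intro DERIV_supporting) auto
      show "(slope x - slope u) * (m / (m + 1) * L x) \<le> 0"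
        using slope_antimono_after_crit[of u x] L_pos[of x] x u v crit m_gt_1
        by (intro mult_nonpos_nonneg) auto
    qed
    show "continuous_on {u..v} (\<lambda>v. D (\<beta> * v) - slope u * D v)"
      by (rule continuous_on_subset[OF continuous_on_supporting]) (use u v crit in auto)
  qed
next
  case False
  then have "v \<le> u" by simp
  then show ?thesis
  proof (rule DERIV_nonneg_imp_increasing_open[where f = "\<lambda>v. D (\<beta> * v) - slope u * D v"])
    show "\<exists>y. DERIV (\<lambda>v. D (\<beta> * v) - slope u * D v) x :> y \<and> 0 \<le> y" if x: "v < x" "x < u" for x
    proof (intro exI conjI)
      show "DERIV (\<lambda>v. D (\<beta> * v) - slope u * D v) x :> (slope x - slope u) * (m / (m + 1) * L x)"
        using x u v crit by (intro DERIV_supporting) auto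
      show "0 \<le> (slope x - slope u) * (m / (m + 1) * L x)"
        using slope_antimono_after_crit[of x u] L_pos[of x] x u v crit m_gt_1
        by (intro mult_nonneg_nonneg) auto
    qed
    show "continuous_on {v..u} (\<lambda>v. D (\<beta> * v) - slope u * D v)"
      by (rule continuous_on_subset[OF continuous_on_supporting]) (use u v crit in auto)
  qed
qed

lemma ratio_mono_before_crit:
  assumes "0 < v" "v \<le> crit"
  shows "D (\<beta> * v) / D v \<le> D (\<beta> * crit) / D crit"
proof (rule DERIV_nonneg_imp_nondecreasing[where f = "\<lambda>v. D (\<beta> * v) / D v", OF assms(2)],
    intro exI conjI)
  fix x assume x: "v \<le> x" "x \<le> crit"
  have D: "0 < D x" using D_pos[of x] x assms crit by auto
  show "((\<lambda>v. D (\<beta> * v) / D v) has_real_derivative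
      (slope x * (m / (m + 1) * L x) * D x - D (\<beta> * x) * (m / (m + 1) * L x)) / (D x * D x)) (at x)"
    by (intro DERIV_divide DERIV_D DERIV_D_scaled') (use x assms crit unscaled_range D in auto)
  have "slope x * (m / (m + 1) * L x) * D x - D (\<beta> * x) * (m / (m + 1) * L x)
      = N x * (m / (m + 1) * L x)"
    by (simp add: N_def algebra_simps)
  also have "0 \<le> \<dots>"
    using N_pos_before[of x] crit(3) x assms crit(2) L_pos[of x] m_gt_1
    by (intro mult_nonneg_nonneg) (cases "x = crit"; auto)+
  finally show "0 \<le> (slope x * (m / (m + 1) * L x) * D x - D (\<beta> * x) * (m / (m + 1) * L x)) / (D x * D x)"
    using D by simp
qed

lemma chord_bound:
  assumes "0 \<le> v" "v \<le> 1"
  shows "D (\<beta> * v) \<le> slope crit * D v"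
proof -
  consider "v = 0" | "0 < v" "v \<le> crit" | "crit \<le> v"
    using assms by linarith
  then show ?thesis
  proof cases
    case 2
    then show ?thesis
      using ratio_mono_before_crit[of v] D_pos[of v] assms crit
      by (simp add: slope_crit pos_divide_le_eq)
  next
    case 3
    then show ?thesis
      using supporting_right[of crit v] crit assms by (simp add: N_def)
  qed simp
qed

text \<open>The tangent of the graph of \<open>D u \<mapsto> D (\<beta> * u)\<close> at a point to the right of the critical
  one lies above the graph at \<open>0\<close> and at the critical point, hence above the chord between them.\<close>

lemma supporting_line:
  assumes u: "crit \<le> u" "u \<le> 1"
  obtains s where "0 \<le> s" "\<And>v. 0 \<le> v \<Longrightarrow> v \<le> 1 \<Longrightarrow> D (\<beta> * v) \<le> D (\<beta> * u) + s * (D v - D u)"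
proof (cases "u = 1")
  case True
  then show ?thesis
    using D_scaled_mono[of _ 1] by (intro that[of 0]) auto
next
  case False
  with u have u1: "u < 1" by simp
  have "D (\<beta> * v) \<le> D (\<beta> * u) + slope u * (D v - D u)" if v: "0 \<le> v" "v \<le> 1" for v
  proof (cases "crit \<le> v")
    case True
    then show ?thesis
      using supporting_right[of u v] u u1 v by (simp add: algebra_simps)
  next
    case False
    then have Dv: "0 \<le> D v" "D v \<le> D crit" "0 < D crit"
      using D_mono[of 0 v] D_mono[of v crit] D_pos[of crit] v crit by auto
    define q where "q = D v / D crit"
    have q: "0 \<le> q" "q \<le> 1" "D v = q * D crit"
      using Dv by (auto simp: q_def)
    have "N u \<le> 0"
      using N_neg_after[of crit u] crit u u1 by (cases "u = crit") auto
    then have "0 \<le> D (\<beta> * u) - slope u * D u"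
      by (simp add: N_def)
    then have "(1 - q) * 0 \<le> (1 - q) * (D (\<beta> * u) - slope u * D u)"
      using q by (intro mult_left_mono) auto
    moreover have "q * (slope crit * D crit - slope u * D crit) \<le> q * (D (\<beta> * u) - slope u * D u)"
      using supporting_right[of u crit] u u1 crit q by (intro mult_left_mono) (auto simp: N_def)
    ultimately show ?thesis
      using chord_bound[OF v] unfolding q(3) by (simp add: algebra_simps)
  qed
  then show ?thesis
    using slope_pos[of u] u u1 crit by (intro that[of "slope u"]) auto
qed

subsection \<open>Extremality of the two-point law\<close>

lemma output_pos:
  assumes "0 \<le> t" "t \<le> m + 1"
  shows "0 < 1 + \<beta> * (t - 1)"
proof (cases "0 < \<beta>")
  case True
  then have "\<beta> * (- 1) \<le> \<beta> * (t - 1)" using assms by (intro mult_left_mono) auto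
  with \<beta>_less show ?thesis by linarith
next
  case False
  then have "\<beta> * m \<le> \<beta> * (t - 1)" using assms by (intro mult_left_mono_neg) auto
  with \<beta>_gt show ?thesis by (simp add: mult.commute)
qed

definition h :: "real \<Rightarrow> real" where
  "h t = \<beta> * ln (1 + \<beta> * (t - 1))"

lemma DERIV_h:
  assumes "0 \<le> t" "t \<le> m + 1"
  shows "(h has_real_derivative \<beta>\<^sup>2 / (1 + \<beta> * (t - 1))) (at t)"
  unfolding h_def[abs_def] using output_pos[OF assms]
  by (auto intro!: derivative_eq_intros simp: power2_eq_square)

lemma h_strict_mono:
  assumes "0 \<le> s" "s < t" "t \<le> m + 1"
  shows "h s < h t"
proof (rule DERIV_pos_imp_increasing[where f = h, OF \<open>s < t\<close>])
  show "\<exists>y. DERIV h x :> y \<and> 0 < y" if "s \<le> x" "x \<le> t" for x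
    by (rule exI, rule conjI, rule DERIV_h)
      (use output_pos[of x] \<beta>_nz that assms in auto)
qed

text \<open>As a function of \<open>ln t\<close>, \<open>h\<close> is strictly convex, so it crosses the chord through \<open>c\<close> and
  \<open>z\<close> exactly there. The crossing is made visible by the numerator of the derivative of the
  difference, which is affine in \<open>t\<close>.\<close>

lemma chord_crossing:
  assumes "0 < c" "c < z" "z \<le> m + 1"
  obtains l where "0 < l"
    "\<And>t. 0 < t \<Longrightarrow> t \<le> c \<Longrightarrow> 0 \<le> h t - h c - l * (ln t - ln c)"
    "\<And>t. c \<le> t \<Longrightarrow> t \<le> z \<Longrightarrow> h t - h c - l * (ln t - ln c) \<le> 0"
    "\<And>t. z \<le> t \<Longrightarrow> t \<le> m + 1 \<Longrightarrow> 0 \<le> h t - h c - l * (ln t - ln c)"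
proof -
  define l where "l = (h z - h c) / (ln z - ln c)"
  define k where "k t = h t - h c - l * (ln t - ln c)" for t
  define r where "r t = \<beta> * (\<beta> - l) * t - l * (1 - \<beta>)" for t
  define k' where "k' t = r t / (t * (1 + \<beta> * (t - 1)))" for t
  have lnz: "0 < ln z - ln c" using assms by simp
  have l: "0 < l"
    unfolding l_def using assms h_strict_mono[of c z] lnz by (intro divide_pos_pos) auto
  have kc: "k c = 0" by (simp add: k_def)
  have kz: "k z = 0" using lnz by (simp add: k_def l_def)
  have deriv: "DERIV k t :> k' t" if "0 < t" "t \<le> m + 1" for t
  proof -
    have "DERIV k t :> \<beta>\<^sup>2 / (1 + \<beta> * (t - 1)) - l * (1 / t)"
      unfolding k_def[abs_def] using that
      by (auto intro!: derivative_eq_intros DERIV_h)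
    moreover have "\<beta>\<^sup>2 / (1 + \<beta> * (t - 1)) - l * (1 / t) = k' t"
      using output_pos[of t] that
      by (simp add: k'_def r_def diff_divide_eq_iff divide_diff_eq_iff)
         (simp add: power2_eq_square algebra_simps)
    ultimately show ?thesis by simp
  qed
  have "\<exists>\<zeta>. c < \<zeta> \<and> \<zeta> < z \<and> DERIV k \<zeta> :> 0"
    using assms kc kz
    by (intro Rolle[where f = k])
       (auto intro!: continuous_at_imp_continuous_on DERIV_isCont[OF deriv]
         simp: real_differentiable_def intro!: exI deriv)
  then obtain \<zeta> where \<zeta>: "c < \<zeta>" "\<zeta> < z" "DERIV k \<zeta> :> 0" by blast
  have "k' \<zeta> = 0"
    using DERIV_unique[OF \<zeta>(3) deriv] \<zeta> assms by simp
  then have r\<zeta>: "r \<zeta> = 0"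
    using output_pos[of \<zeta>] \<zeta> assms by (simp add: k'_def)
  then have "\<beta> * (\<beta> - l) * \<zeta> = l * (1 - \<beta>)" by (simp add: r_def)
  moreover have "0 < l * (1 - \<beta>)" using l \<beta>_less by simp
  ultimately have lead: "0 < \<beta> * (\<beta> - l)"
    using \<zeta> assms by (metis less_trans zero_less_mult_pos2)
  have r: "r t \<le> 0 \<longleftrightarrow> t \<le> \<zeta>" for t
  proof -
    have "r t = \<beta> * (\<beta> - l) * (t - \<zeta>)"
      using r\<zeta> by (simp add: r_def algebra_simps)
    moreover have "q * y \<le> 0 \<longleftrightarrow> y \<le> 0" if "0 < q" for q y :: real
      using that by (auto simp: mult_le_0_iff)
    ultimately show ?thesis
      using lead by simp
  qed
  have dec: "k t \<le> k s" if "0 < s" "s \<le> t" "t \<le> \<zeta>" for s t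
  proof (rule DERIV_nonpos_imp_nonincreasing[where f = k, OF that(2)], intro exI conjI)
    fix x assume x: "s \<le> x" "x \<le> t"
    show "DERIV k x :> k' x" using x that \<zeta> assms by (intro deriv) auto
    show "k' x \<le> 0"
      unfolding k'_def using r[of x] output_pos[of x] x that \<zeta> assms
      by (intro divide_nonpos_pos) auto
  qed
  have inc: "k s \<le> k t" if "\<zeta> \<le> s" "s \<le> t" "t \<le> m + 1" for s t
  proof (rule DERIV_nonneg_imp_nondecreasing[where f = k, OF that(2)], intro exI conjI)
    fix x assume x: "s \<le> x" "x \<le> t"
    show "DERIV k x :> k' x" using x that \<zeta> assms by (intro deriv) auto
    have "0 \<le> r x" using r[of x] r\<zeta> x that by (cases "x = \<zeta>") auto
    then show "0 \<le> k' x"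
      unfolding k'_def using output_pos[of x] x that \<zeta> assms
      by (intro divide_nonneg_pos) auto
  qed
  show ?thesis
  proof (rule that[OF l])
    show "0 \<le> h t - h c - l * (ln t - ln c)" if "0 < t" "t \<le> c" for t
      using dec[of t c] kc \<zeta> that by (simp add: k_def)
    show "h t - h c - l * (ln t - ln c) \<le> 0" if "c \<le> t" "t \<le> z" for t
      using dec[of c t] inc[of t z] kc kz \<zeta> that assms by (cases "t \<le> \<zeta>") (auto simp: k_def)
    show "0 \<le> h t - h c - l * (ln t - ln c)" if "z \<le> t" "t \<le> m + 1" for t
      using inc[of z t] kz \<zeta> that by (simp add: k_def)
  qed
qed

lemma two_point_extremal:
  assumes "0 < c" "c < z" "z \<le> a" "a \<le> m + 1"
  obtains l \<mu> where "0 < l"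
    "\<And>t. 0 \<le> t \<Longrightarrow> t \<le> z \<Longrightarrow>
      xlnx (1 + \<beta> * (t - 1)) - l * xlnx t - \<mu> * t \<le> xlnx (1 + \<beta> * (c - 1)) - l * xlnx c - \<mu> * c"
    "xlnx (1 + \<beta> * (z - 1)) - l * xlnx z - \<mu> * z \<le> xlnx (1 + \<beta> * (a - 1)) - l * xlnx a - \<mu> * a"
proof -
  obtain l where l: "0 < l"
    "\<And>t. 0 < t \<Longrightarrow> t \<le> c \<Longrightarrow> 0 \<le> h t - h c - l * (ln t - ln c)"
    "\<And>t. c \<le> t \<Longrightarrow> t \<le> z \<Longrightarrow> h t - h c - l * (ln t - ln c) \<le> 0"
    "\<And>t. z \<le> t \<Longrightarrow> t \<le> m + 1 \<Longrightarrow> 0 \<le> h t - h c - l * (ln t - ln c)"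
    using chord_crossing[of c z] assms by auto
  define \<mu> where "\<mu> = \<beta> + h c - l * (1 + ln c)"
  define Q where "Q t = xlnx (1 + \<beta> * (t - 1)) - l * xlnx t - \<mu> * t" for t
  have deriv: "DERIV Q t :> h t - h c - l * (ln t - ln c)" if "0 < t" "t \<le> m + 1" for t
    unfolding Q_def[abs_def] using output_pos[of t] that
    by (auto intro!: derivative_eq_intros simp: \<mu>_def h_def algebra_simps)
  have cont: "continuous_on {s..t} Q" if "0 \<le> s" "t \<le> m + 1" for s t
    unfolding Q_def[abs_def] using that output_pos
    by (intro continuous_intros) (auto intro: less_imp_le)
  show ?thesis
  proof (rule that[of l \<mu>, OF l(1), folded Q_def])
    show "Q t \<le> Q c" if t: "0 \<le> t" "t \<le> z" for t
    proof (cases "t \<le> c")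
      case True
      then show ?thesis
      proof (rule DERIV_nonneg_imp_increasing_open[where f = Q])
        show "\<exists>y. DERIV Q x :> y \<and> 0 \<le> y" if "t < x" "x < c" for x
          by (rule exI, rule conjI, rule deriv) (use l(2)[of x] that assms t in auto)
      qed (use cont t assms in auto)
    next
      case False
      then have "c \<le> t" by simp
      then show ?thesis
      proof (rule DERIV_nonpos_imp_decreasing_open[where f = Q])
        show "\<exists>y. DERIV Q x :> y \<and> y \<le> 0" if "c < x" "x < t" for x
          by (rule exI, rule conjI, rule deriv) (use l(3)[of x] that assms t in auto)
      qed (use cont t assms in auto)
    qed
    show "Q z \<le> Q a"
    proof (rule DERIV_nonneg_imp_increasing_open[where f = Q, OF \<open>z \<le> a\<close>])
      show "\<exists>y. DERIV Q x :> y \<and> 0 \<le> y" if "z < x" "x < a" for x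
        by (rule exI, rule conjI, rule deriv) (use l(4)[of x] that assms in auto)
    qed (use cont assms in auto)
  qed
qed

lemma sum_le_one_vs_rest:
  fixes f :: "'x::finite \<Rightarrow> real"
  assumes "real CARD('x) = m + 1" "\<And>i. i \<noteq> j \<Longrightarrow> f i \<le> A" "f j \<le> B"
  shows "sum f UNIV \<le> m * A + B"
proof -
  have "sum f UNIV = f j + sum f (UNIV - {j})"
    by (rule sum.remove) auto
  also have "sum f (UNIV - {j}) \<le> (\<Sum>i\<in>UNIV - {j}. A)"
    using assms(2) by (intro sum_mono) auto
  also have "\<dots> = m * A"
    using assms(1) by (simp add: card_Diff_singleton of_nat_diff Suc_leI)
  finally show ?thesis using assms(3) by simp
qed

lemma D_le_of_coordinate:
  fixes x :: "'x::finite \<Rightarrow> real"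
  assumes n: "real CARD('x) = m + 1"
    and x: "\<And>i. 0 \<le> x i" "sum x UNIV = m + 1" "x j = 1 + m * w" "w \<le> 1"
  shows "D w \<le> (\<Sum>i\<in>UNIV. xlnx (x i)) / (m + 1)"
proof -
  have split: "sum f UNIV = f j + sum f (UNIV - {j})" for f :: "'x \<Rightarrow> real"
    by (rule sum.remove) auto
  have rest: "(\<Sum>i\<in>UNIV - {j}. x i) = m * (1 - w)"
    using split[of x] x by (simp add: algebra_simps)
  have card: "real (card (UNIV - {j})) = m"
    using n by (simp add: card_Diff_singleton of_nat_diff Suc_leI)
  have "m * xlnx (1 - w) \<le> (\<Sum>i\<in>UNIV - {j}. xlnx (x i))"
  proof (cases "w = 1")
    case True
    then have "\<forall>i\<in>UNIV - {j}. x i = 0"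
      using rest x(1) sum_nonneg_eq_0_iff[of "UNIV - {j}" x] by simp
    then show ?thesis using True by simp
  next
    case False
    with x have w: "0 < 1 - w" by simp
    have "(\<Sum>i\<in>UNIV - {j}. xlnx (1 - w) + (1 + ln (1 - w)) * (x i - (1 - w)))
        \<le> (\<Sum>i\<in>UNIV - {j}. xlnx (x i))"
      using x w by (intro sum_mono xlnx_ge_tangent) auto
    moreover have "(\<Sum>i\<in>UNIV - {j}. xlnx (1 - w) + (1 + ln (1 - w)) * (x i - (1 - w)))
        = real (card (UNIV - {j})) * xlnx (1 - w)
          + (1 + ln (1 - w)) * ((\<Sum>i\<in>UNIV - {j}. x i) - real (card (UNIV - {j})) * (1 - w))"
      by (simp add: sum.distrib sum_subtractf flip: sum_distrib_left)
    ultimately show ?thesis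
      by (simp only: card rest) simp
  qed
  then show ?thesis
    using split[of "\<lambda>i. xlnx (x i)"] x(3) m_gt_1 by (simp add: D_def divide_right_mono)
qed

lemma output_divergence_le_D_beta:
  fixes x :: "'x::finite \<Rightarrow> real"
  assumes n: "real CARD('x) = m + 1"
    and x: "\<And>i. 0 \<le> x i" "\<And>i. x i \<le> m + 1" "sum x UNIV = m + 1"
  shows "(\<Sum>i\<in>UNIV. xlnx (1 + \<beta> * (x i - 1))) / (m + 1) \<le> D \<beta>"
proof -
  have pos: "0 < 1 - \<beta>" "0 < 1 + m * \<beta>" using \<beta>_less \<beta>_gt by auto
  have "(\<Sum>i\<in>UNIV. xlnx (1 + \<beta> * (x i - 1)))
      \<le> (\<Sum>i\<in>UNIV. (1 - x i / (m + 1)) * xlnx (1 - \<beta>) + x i / (m + 1) * xlnx (1 + m * \<beta>))"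
  proof (rule sum_mono)
    fix i
    define s where "s = x i / (m + 1)"
    have s: "0 \<le> s" "s \<le> 1" "x i = s * (m + 1)"
      using x(1,2)[of i] m_gt_1 by (auto simp: s_def)
    have "1 + \<beta> * (x i - 1) = (1 - s) * (1 - \<beta>) + s * (1 + m * \<beta>)"
      by (simp add: s(3) algebra_simps)
    then show "xlnx (1 + \<beta> * (x i - 1))
        \<le> (1 - x i / (m + 1)) * xlnx (1 - \<beta>) + x i / (m + 1) * xlnx (1 + m * \<beta>)"
      unfolding s_def[symmetric] using xlnx_le_chord[OF s(1,2) pos] by simp
  qed
  also have "\<dots> = (real CARD('x) - sum x UNIV / (m + 1)) * xlnx (1 - \<beta>)
      + sum x UNIV / (m + 1) * xlnx (1 + m * \<beta>)"
    by (simp add: sum.distrib sum_subtractf flip: sum_distrib_right sum_divide_distrib)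
  also have "\<dots> = m * xlnx (1 - \<beta>) + xlnx (1 + m * \<beta>)"
    using n x(3) m_gt_1 by simp
  finally show ?thesis
    using m_gt_1 by (simp add: D_def divide_right_mono)
qed

lemma output_divergence_le:
  fixes x :: "'x::finite \<Rightarrow> real"
  assumes n: "real CARD('x) = m + 1"
    and x: "\<And>i. 0 \<le> x i" "sum x UNIV = m + 1"
    and u: "0 \<le> u" "u \<le> 1" and le: "(\<Sum>i\<in>UNIV. xlnx (x i)) / (m + 1) \<le> D u"
  shows "(\<Sum>i\<in>UNIV. xlnx (1 + \<beta> * (x i - 1))) / (m + 1) \<le> D (\<beta> * u)"
proof (cases "u = 1")
  case True
  have "x i \<le> m + 1" for i
    using member_le_sum[of i UNIV x] x by auto
  then show ?thesis
    using output_divergence_le_D_beta[OF n x(1) _ x(2)] True by simp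
next
  case False
  with u have u1: "u < 1" by simp
  obtain j where j: "\<And>i. x i \<le> x j"
  proof -
    have "Max (range x) \<in> range x" by (intro Max_in) auto
    then obtain j where "Max (range x) = x j" by (rule imageE)
    then show ?thesis using that[of j] by (metis Max_ge finite finite_imageI rangeI)
  qed
  define w where "w = (x j - 1) / m"
  have xj: "x j = 1 + m * w" using m_gt_1 by (simp add: w_def)
  have "m + 1 \<le> (m + 1) * x j"
    using sum_bounded_above[of UNIV x "x j"] j x n by simp
  then have "0 \<le> w"
    using m_gt_1 by (simp add: w_def)
  have "x j \<le> m + 1"
    using member_le_sum[of j UNIV x] x by auto
  then have "w \<le> 1"
    using m_gt_1 by (simp add: w_def)
  then have "D w \<le> D u"
    using D_le_of_coordinate[OF n x xj] le by linarith
  then have "w \<le> u"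
    using D_strict_mono[of u w] u \<open>w \<le> 1\<close> by (metis not_le)
  show ?thesis
  proof (cases "w = 0")
    case True
    then have "(\<Sum>i\<in>UNIV. 1 - x i) = 0" "\<And>i. 0 \<le> 1 - x i"
      using j xj x n by (auto simp: sum_subtractf)
    then have "x i = 1" for i
      using sum_nonneg_eq_0_iff[of UNIV "\<lambda>i. 1 - x i"] by simp
    then show ?thesis
      using D_scaled_mono[of 0 u] u by simp
  next
    case False
    with \<open>0 \<le> w\<close> have "0 < w" by simp
    then have "0 < m * w" "m * w \<le> m * u" "m * u \<le> m * 1"
      using m_gt_1 \<open>w \<le> u\<close> u by (auto intro: mult_pos_pos)
    then have z: "1 - u < x j" "x j \<le> 1 + m * u" "1 + m * u \<le> m + 1"
      using u xj by linarith+
    obtain l \<mu> where l: "0 < l"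
      "\<And>t. 0 \<le> t \<Longrightarrow> t \<le> x j \<Longrightarrow> xlnx (1 + \<beta> * (t - 1)) - l * xlnx t - \<mu> * t
        \<le> xlnx (1 + \<beta> * ((1 - u) - 1)) - l * xlnx (1 - u) - \<mu> * (1 - u)"
      "xlnx (1 + \<beta> * (x j - 1)) - l * xlnx (x j) - \<mu> * x j
        \<le> xlnx (1 + \<beta> * ((1 + m * u) - 1)) - l * xlnx (1 + m * u) - \<mu> * (1 + m * u)"
      using two_point_extremal[of "1 - u" "x j" "1 + m * u"] z u1 by (auto simp: algebra_simps)
    have "(\<Sum>i\<in>UNIV. xlnx (1 + \<beta> * (x i - 1)) - l * xlnx (x i) - \<mu> * x i)
        \<le> m * (xlnx (1 + \<beta> * ((1 - u) - 1)) - l * xlnx (1 - u) - \<mu> * (1 - u))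
          + (xlnx (1 + \<beta> * ((1 + m * u) - 1)) - l * xlnx (1 + m * u) - \<mu> * (1 + m * u))"
      by (rule sum_le_one_vs_rest[where j = j, OF n]) (use l x j in auto)
    also have "\<dots> = (m * xlnx (1 - \<beta> * u) + xlnx (1 + m * (\<beta> * u)))
        - l * (m * xlnx (1 - u) + xlnx (1 + m * u)) - \<mu> * (m + 1)"
      by (simp add: algebra_simps)
    also have "\<dots> = (m + 1) * D (\<beta> * u) - l * ((m + 1) * D u) - \<mu> * (m + 1)"
      using m_gt_1 by (simp add: D_def)
    finally have "(\<Sum>i\<in>UNIV. xlnx (1 + \<beta> * (x i - 1))) - l * (\<Sum>i\<in>UNIV. xlnx (x i))
        \<le> (m + 1) * D (\<beta> * u) - l * ((m + 1) * D u)"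
      using x(2) by (simp add: sum_subtractf flip: sum_distrib_left)
    moreover have "l * (\<Sum>i\<in>UNIV. xlnx (x i)) \<le> l * ((m + 1) * D u)"
      using le l(1) m_gt_1 by (intro mult_left_mono) (auto simp: pos_divide_le_eq mult.commute)
    ultimately have "(\<Sum>i\<in>UNIV. xlnx (1 + \<beta> * (x i - 1))) \<le> (m + 1) * D (\<beta> * u)"
      by linarith
    then show ?thesis
      using m_gt_1 by (simp add: pos_divide_le_eq mult.commute)
  qed
qed

end

subsection \<open>Mutual information over channels with uniform input\<close>

definition kl_uniform :: "('x::finite \<Rightarrow> real) \<Rightarrow> real" where
  "kl_uniform q = (\<Sum>i\<in>UNIV. xlnx (real CARD('x) * q i)) / real CARD('x)"

lemma kl_uniform_eq: "kl_uniform (q :: 'x::finite \<Rightarrow> real) = (\<Sum>i\<in>UNIV. q i * ln (real CARD('x) * q i))"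
  by (simp add: kl_uniform_def xlnx_def sum_divide_distrib mult.assoc)

lemma entropy_deficit_eq:
  fixes p :: "'x::finite pmf"
  assumes "1 < b"
  shows "log b (real CARD('x)) - pmf_entropy b p = kl_uniform (pmf p) / ln b"
proof -
  have "kl_uniform (pmf p) = (\<Sum>i\<in>UNIV. pmf p i * ln (real CARD('x)) + pmf p i * ln (pmf p i))"
    unfolding kl_uniform_eq
  proof (rule sum.cong)
    fix i
    show "pmf p i * ln (real CARD('x) * pmf p i)
        = pmf p i * ln (real CARD('x)) + pmf p i * ln (pmf p i)"
      by (cases "pmf p i = 0") (auto simp: ln_mult algebra_simps pmf_pos)
  qed simp
  also have "\<dots> = ln (real CARD('x)) + (\<Sum>i\<in>UNIV. pmf p i * ln (pmf p i))"
    by (simp add: sum.distrib sum_pmf_eq_1 flip: sum_distrib_right)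
  finally show ?thesis
    by (simp add: pmf_entropy_eq[OF assms] log_def add_divide_distrib sum_divide_distrib)
qed

lemma pmf_bind_finite:
  fixes p :: "'x::finite pmf"
  shows "pmf (bind_pmf p f) z = (\<Sum>x\<in>UNIV. pmf p x * pmf (f x) z)"
  unfolding pmf_bind by (subst integral_measure_pmf[of UNIV]) (auto simp: mult.commute)

lemma mutual_information_uniform:
  fixes Q :: "'w pmf" and Z :: "'w \<Rightarrow> 'x::finite" and T :: "'w \<Rightarrow> nat"
  assumes b: "1 < b" and fin: "finite (set_pmf Q)" "finite A" "T ` set_pmf Q \<subseteq> A"
    and J: "\<And>z t. pmf (map_pmf (\<lambda>w. (Z w, T w)) Q) (z, t) = P t * q t z"
    and Z: "\<And>z. pmf (map_pmf Z Q) z = 1 / real CARD('x)"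
    and T: "\<And>t. pmf (map_pmf T Q) t = P t"
  shows "pmf_mutual_information b Q Z T = (\<Sum>t\<in>A. P t * kl_uniform (q t)) / ln b"
proof -
  define J where "J = map_pmf (\<lambda>w. (Z w, T w)) Q"
  have "pmf_mutual_information b Q Z T = (\<Sum>(z, t)\<in>(\<lambda>w. (Z w, T w)) ` set_pmf Q.
      pmf J (z, t) * log b (pmf J (z, t) / (pmf (map_pmf Z Q) z * pmf (map_pmf T Q) t)))"
    unfolding J_def by (rule pmf_mutual_information_eq[OF b fin(1)])
  also have "\<dots> = (\<Sum>(z, t)\<in>UNIV \<times> A.
      pmf J (z, t) * log b (pmf J (z, t) / (pmf (map_pmf Z Q) z * pmf (map_pmf T Q) t)))"
    using fin by (intro sum.mono_neutral_left) (auto simp: J_def pmf_eq_0_set_pmf)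
  also have "\<dots> = (\<Sum>(z, t)\<in>UNIV \<times> A. P t * (q t z * ln (real CARD('x) * q t z)) / ln b)"
  proof (intro sum.cong refl)
    fix zt :: "'x \<times> nat"
    obtain z t where zt: "zt = (z, t)" by (cases zt)
    show "(case zt of (z, t) \<Rightarrow>
        pmf J (z, t) * log b (pmf J (z, t) / (pmf (map_pmf Z Q) z * pmf (map_pmf T Q) t)))
      = (case zt of (z, t) \<Rightarrow> P t * (q t z * ln (real CARD('x) * q t z)) / ln b)"
      unfolding zt J_def by (cases "P t = 0") (simp_all add: J Z T log_def mult.commute)
  qed
  also have "\<dots> = (\<Sum>t\<in>A. \<Sum>z\<in>UNIV. P t * (q t z * ln (real CARD('x) * q t z)) / ln b)"
    by (subst sum.swap) (simp add: sum.cartesian_product)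
  also have "\<dots> = (\<Sum>t\<in>A. P t * kl_uniform (q t)) / ln b"
    by (simp add: kl_uniform_eq sum_distrib_left sum_divide_distrib)
  finally show ?thesis .
qed

lemma map_markov_joint:
  shows "map_pmf (\<lambda>(y, x, t). (y, t)) (markov_joint p W V) = bind_pmf p (\<lambda>x. pair_pmf (W x) (V x))"
    and "map_pmf (\<lambda>(y, x, t). (x, t)) (markov_joint p W V)
      = bind_pmf p (\<lambda>x. pair_pmf (return_pmf x) (V x))"
    and "map_pmf (\<lambda>(y, x, t). y) (markov_joint p W V) = bind_pmf p W"
    and "map_pmf (\<lambda>(y, x, t). x) (markov_joint p W V) = bind_pmf p return_pmf"
    and "map_pmf (\<lambda>(y, x, t). t) (markov_joint p W V) = bind_pmf p V"
  by (simp_all add: markov_joint_def map_bind_pmf pair_pmf_def bind_return_pmf bind_return_pmf')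

lemma set_pmf_markov_joint:
  fixes p :: "'x::finite pmf" and W :: "'x \<Rightarrow> 'y::finite pmf"
  assumes "finite A" "\<And>x. set_pmf (V x) \<subseteq> A"
  shows "set_pmf (markov_joint p W V) \<subseteq> UNIV \<times> UNIV \<times> A" "finite (set_pmf (markov_joint p W V))"
proof -
  show "set_pmf (markov_joint p W V) \<subseteq> UNIV \<times> UNIV \<times> A"
    using assms(2) by (auto simp: markov_joint_def)
  then show "finite (set_pmf (markov_joint p W V))"
    by (rule finite_subset) (use assms(1) in auto)
qed

definition hamming_output :: "real \<Rightarrow> ('x::finite \<Rightarrow> real) \<Rightarrow> 'x \<Rightarrow> real" where
  "hamming_output s q y = (1 - s) / real CARD('x) + s * q y"

definition hamming_like :: "real \<Rightarrow> ('x::finite \<Rightarrow> 'x pmf) \<Rightarrow> bool" where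
  "hamming_like s K \<longleftrightarrow> (\<forall>x y. pmf (K x) y = (1 - s) / real CARD('x) + (if x = y then s else 0))"

lemma hamming_like_return: "hamming_like 1 return_pmf"
  by (auto simp: hamming_like_def indicator_def)

lemma hamming_like_hamming_channel:
  assumes "-1 \<le> (real CARD('x) - 1) * s" "s \<le> 1"
  shows "hamming_like s (hamming_channel ((1 - s) / real CARD('x)) :: 'x::finite \<Rightarrow> 'x pmf)"
proof -
  define n where "n = real CARD('x)"
  have n: "0 < n" by (simp add: n_def)
  have 1: "0 \<le> (1 - s) / n" "(n - 1) * ((1 - s) / n) \<le> 1"
    using assms n unfolding n_def[symmetric] by (auto simp: field_simps)
  have 2: "1 - (n - 1) * ((1 - s) / n) = (1 - s) / n + s"
    using n by (simp add: field_simps)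
  show ?thesis
    unfolding hamming_like_def using pmf_hamming_channel[where 'a = 'x] 1 2
    unfolding n_def by auto
qed

lemma sum_hamming_like:
  fixes K :: "'x::finite \<Rightarrow> 'x pmf"
  assumes "hamming_like s K"
  shows "(\<Sum>x\<in>UNIV. f x * pmf (K x) z) = (1 - s) / real CARD('x) * sum f UNIV + s * f z"
proof -
  have "(\<Sum>x\<in>UNIV. f x * pmf (K x) z)
      = (\<Sum>x\<in>UNIV. f x * ((1 - s) / real CARD('x)) + (if x = z then s * f x else 0))"
    using assms by (intro sum.cong) (auto simp: hamming_like_def algebra_simps)
  also have "\<dots> = (1 - s) / real CARD('x) * sum f UNIV + s * f z"
    by (simp only: sum.distrib flip: sum_distrib_right) (simp add: mult.commute)
  finally show ?thesis .
qed

lemma pmf_bind_hamming_like: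
  assumes "hamming_like s K"
  shows "pmf (bind_pmf p K) z = hamming_output s (pmf p) z"
  by (simp add: pmf_bind_finite sum_hamming_like[OF assms] hamming_output_def sum_pmf_eq_1)

lemma joint_hamming_like:
  fixes K :: "'x::finite \<Rightarrow> 'x pmf" and V :: "'x \<Rightarrow> nat pmf"
  assumes K: "hamming_like s K"
    and V: "\<And>x t. pmf (V x) t / real CARD('x) = P t * r t x"
    and P: "\<And>t. pmf (bind_pmf (pmf_of_set UNIV) V) t = P t"
  shows "pmf (bind_pmf (pmf_of_set UNIV) (\<lambda>x. pair_pmf (K x) (V x))) (z, t)
    = P t * hamming_output s (r t) z"
proof -
  have "pmf (bind_pmf (pmf_of_set UNIV) V) t = (\<Sum>x\<in>UNIV. P t * r t x)"
    unfolding pmf_bind_finite by (intro sum.cong refl) (simp add: V[symmetric])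
  then have "(\<Sum>x\<in>UNIV. P t * r t x) = P t"
    by (simp only: P)
  moreover have "pmf (bind_pmf (pmf_of_set UNIV) (\<lambda>x. pair_pmf (K x) (V x))) (z, t)
      = (\<Sum>x\<in>UNIV. (P t * r t x) * pmf (K x) z)"
    unfolding pmf_bind_finite by (intro sum.cong refl) (simp add: pmf_pair V[symmetric])
  ultimately show ?thesis
    by (simp only: sum_hamming_like[OF K] hamming_output_def) (simp add: algebra_simps)
qed

lemma mutual_information_markov_joint:
  fixes W :: "'x::finite \<Rightarrow> 'x pmf" and V :: "'x \<Rightarrow> nat pmf"
  assumes b: "1 < b" and A: "finite A" "\<And>x. set_pmf (V x) \<subseteq> A"
    and W: "hamming_like s W"
    and V: "\<And>x t. pmf (V x) t / real CARD('x) = P t * r t x"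
    and P: "\<And>t. pmf (bind_pmf (pmf_of_set UNIV) V) t = P t"
  defines "Q \<equiv> markov_joint (pmf_of_set UNIV) W V"
  shows "pmf_mutual_information b Q (\<lambda>(y, x, t). y) (\<lambda>(y, x, t). t)
      = (\<Sum>t\<in>A. P t * kl_uniform (hamming_output s (r t))) / ln b"
    and "pmf_mutual_information b Q (\<lambda>(y, x, t). x) (\<lambda>(y, x, t). t)
      = (\<Sum>t\<in>A. P t * kl_uniform (r t)) / ln b"
proof -
  have sub: "(\<lambda>(y, x, t). t) ` set_pmf Q \<subseteq> A" and fin: "finite (set_pmf Q)"
    using set_pmf_markov_joint[where V = V, OF A, of "pmf_of_set UNIV" W] by (auto simp: Q_def)
  have uniform: "pmf (bind_pmf (pmf_of_set UNIV) K) z = 1 / real CARD('x)" if "hamming_like s K"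
    for K :: "'x \<Rightarrow> 'x pmf" and s z
    unfolding pmf_bind_hamming_like[OF that] hamming_output_def
    by (simp add: field_simps)
  show "pmf_mutual_information b Q (\<lambda>(y, x, t). y) (\<lambda>(y, x, t). t)
      = (\<Sum>t\<in>A. P t * kl_uniform (hamming_output s (r t))) / ln b"
  proof (rule mutual_information_uniform[OF b fin A(1) sub])
    have pair: "(\<lambda>w. ((\<lambda>(y, x, t). y) w, (\<lambda>(y, x, t). t) w))
        = (\<lambda>(y :: 'x, x :: 'x, t :: nat). (y, t))" by auto
    show "pmf (map_pmf (\<lambda>w. ((\<lambda>(y, x, t). y) w, (\<lambda>(y, x, t). t) w)) Q) (z, t)
        = P t * hamming_output s (r t) z" for z t
      unfolding pair Q_def map_markov_joint by (rule joint_hamming_like[OF W V P])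
  qed (simp_all add: Q_def map_markov_joint uniform[OF W] P)
  have out: "hamming_output 1 q = q" for q :: "'x \<Rightarrow> real"
    by (auto simp: hamming_output_def)
  show "pmf_mutual_information b Q (\<lambda>(y, x, t). x) (\<lambda>(y, x, t). t)
      = (\<Sum>t\<in>A. P t * kl_uniform (r t)) / ln b"
  proof (rule mutual_information_uniform[OF b fin A(1) sub])
    have pair: "(\<lambda>w. ((\<lambda>(y, x, t). x) w, (\<lambda>(y, x, t). t) w))
        = (\<lambda>(y :: 'x, x :: 'x, t :: nat). (x, t))" by auto
    show "pmf (map_pmf (\<lambda>w. ((\<lambda>(y, x, t). x) w, (\<lambda>(y, x, t). t) w)) Q) (z, t)
        = P t * r t z" for z t
      unfolding pair Q_def map_markov_joint
      using joint_hamming_like[OF hamming_like_return V P, of z t] by (simp add: out)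
    show "pmf (map_pmf (\<lambda>(y, x, t). x) Q) z = 1 / real CARD('x)" for z
      unfolding Q_def map_markov_joint by (rule uniform[OF hamming_like_return])
  qed (simp add: Q_def map_markov_joint P)
qed

context symmetric_channel
begin

subsection \<open>The information bottleneck function\<close>

context
  fixes W :: "'x::finite \<Rightarrow> 'x pmf" and b :: real
  assumes card: "real CARD('x) = m + 1" and W: "hamming_like \<beta> W" and b: "1 < b"
begin

lemma kl_uniform_hamming_output:
  fixes q :: "'x \<Rightarrow> real"
  assumes "\<And>i. 0 \<le> q i" "sum q UNIV = 1" "0 \<le> u" "u \<le> 1" "kl_uniform q \<le> D u"
  shows "kl_uniform (hamming_output \<beta> q) \<le> D (\<beta> * u)"
proof -
  have "(m + 1) * hamming_output \<beta> q i = 1 + \<beta> * ((m + 1) * q i - 1)" for i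
    using m_gt_1 unfolding hamming_output_def card by (simp add: field_simps)
  moreover have "(\<Sum>i\<in>UNIV. xlnx (1 + \<beta> * ((m + 1) * q i - 1))) / (m + 1) \<le> D (\<beta> * u)"
    using assms m_gt_1
    by (intro output_divergence_le[OF card]) (auto simp: kl_uniform_def card simp flip: sum_distrib_left)
  ultimately show ?thesis
    by (simp add: kl_uniform_def card)
qed

lemma kl_uniform_eq_D:
  fixes q :: "'x \<Rightarrow> real"
  assumes q: "\<And>i. 0 \<le> q i" "sum q UNIV = 1"
  obtains u where "0 \<le> u" "u \<le> 1" "kl_uniform q = D u"
proof -
  have "(\<Sum>i\<in>UNIV. xlnx 1 + (1 + ln 1) * ((m + 1) * q i - 1))
      \<le> (\<Sum>i\<in>UNIV. xlnx ((m + 1) * q i))"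
    using q m_gt_1 by (intro sum_mono xlnx_ge_tangent) auto
  moreover have "(\<Sum>i\<in>UNIV. xlnx 1 + (1 + ln 1) * ((m + 1) * q i - 1)) = 0"
    using q card by (simp add: sum_subtractf flip: sum_distrib_left)
  ultimately have 0: "0 \<le> kl_uniform q"
    using m_gt_1 by (simp add: kl_uniform_def card)
  have "(\<Sum>i\<in>UNIV. q i * ln ((m + 1) * q i)) \<le> (\<Sum>i\<in>UNIV. q i * ln (m + 1))"
  proof (rule sum_mono)
    fix i
    have "q i \<le> 1"
      using member_le_sum[of i UNIV q] q by auto
    then show "q i * ln ((m + 1) * q i) \<le> q i * ln (m + 1)"
      using q(1)[of i] m_gt_1 by (cases "q i = 0") (auto intro!: mult_left_mono)
  qed
  also have "\<dots> = ln (m + 1)"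
    using q by (simp flip: sum_distrib_right)
  finally have 1: "kl_uniform q \<le> D 1"
    by (simp add: kl_uniform_eq card D_1)
  have "\<exists>u\<ge>0. u \<le> 1 \<and> D u = kl_uniform q"
    by (rule IVT') (use 0 1 continuous_on_D in auto)
  then show ?thesis using that by metis
qed

lemma kl_uniform_two_point:
  "kl_uniform (\<lambda>x :: 'x. (1 - s) / (m + 1) + (if x = j then s else 0)) = D s"
proof -
  have eq: "(m + 1) * ((1 - s) / (m + 1) + (if x = j then s else 0))
      = (if x = j then 1 + m * s else 1 - s)" for x
    using m_gt_1 by (auto simp: field_simps)
  have "(\<Sum>x\<in>UNIV. xlnx ((m + 1) * ((1 - s) / (m + 1) + (if x = j then s else 0))))
      = xlnx (1 + m * s) + (\<Sum>x\<in>UNIV - {j}. xlnx (1 - s))"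
    unfolding eq by (subst sum.remove[of _ j]) auto
  also have "(\<Sum>x\<in>UNIV - {j}. xlnx (1 - s)) = m * xlnx (1 - s)"
    using card by (simp add: card_Diff_singleton of_nat_diff Suc_leI)
  finally show ?thesis
    by (simp add: kl_uniform_def card D_def)
qed

lemma hamming_output_two_point:
  "hamming_output \<beta> (\<lambda>x :: 'x. (1 - s) / (m + 1) + (if x = j then s else 0))
    = (\<lambda>x. (1 - \<beta> * s) / (m + 1) + (if x = j then \<beta> * s else 0))"
proof
  show "hamming_output \<beta> (\<lambda>x :: 'x. (1 - s) / (m + 1) + (if x = j then s else 0)) x
      = (1 - \<beta> * s) / (m + 1) + (if x = j then \<beta> * s else 0)" for x
    using m_gt_1 by (simp add: hamming_output_def card divide_simps) (simp add: algebra_simps)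
qed

lemma hamming_like_channel:
  assumes "0 \<le> u" "u \<le> 1"
  shows "hamming_like u (hamming_channel ((1 - u) / (m + 1)) :: 'x \<Rightarrow> 'x pmf)"
  using hamming_like_hamming_channel[where 'x = 'x, of u] unscaled_range[of u] assms by (simp add: card)

lemma phi_eq:
  assumes u: "0 \<le> u" "u \<le> 1"
  shows "phi b W (D u / ln b) = D (\<beta> * u) / ln b"
  unfolding phi_def
proof (rule Greatest_equality)
  define p where "p = (hamming_channel ((1 - u) / (m + 1)) :: 'x \<Rightarrow> 'x pmf) undefined"
  have p: "pmf p = (\<lambda>x. (1 - u) / (m + 1) + (if x = undefined then u else 0))"
    using hamming_like_channel[OF u] by (auto simp: p_def hamming_like_def card)
  have Wp: "pmf (bind_pmf p W) = hamming_output \<beta> (pmf p)"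
    using pmf_bind_hamming_like[OF W] by auto
  show "\<exists>p :: 'x pmf. log b (real CARD('x)) - pmf_entropy b p \<le> D u / ln b \<and>
      D (\<beta> * u) / ln b = log b (real CARD('x)) - pmf_entropy b (bind_pmf p W)"
    by (rule exI[of _ p], unfold entropy_deficit_eq[OF b] Wp, unfold p hamming_output_two_point kl_uniform_two_point)
       simp
next
  fix v
  assume "\<exists>p :: 'x pmf. log b (real CARD('x)) - pmf_entropy b p \<le> D u / ln b \<and>
      v = log b (real CARD('x)) - pmf_entropy b (bind_pmf p W)"
  then obtain p :: "'x pmf" where
    p: "kl_uniform (pmf p) / ln b \<le> D u / ln b" "v = kl_uniform (pmf (bind_pmf p W)) / ln b"
    unfolding entropy_deficit_eq[OF b] by blast
  have "pmf (bind_pmf p W) = hamming_output \<beta> (pmf p)"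
    using pmf_bind_hamming_like[OF W] by auto
  moreover have "kl_uniform (hamming_output \<beta> (pmf p)) \<le> D (\<beta> * u)"
    using p(1) b u by (intro kl_uniform_hamming_output) (auto simp: sum_pmf_eq_1 divide_le_cancel)
  ultimately show "v \<le> D (\<beta> * u) / ln b"
    using p(2) b by (simp add: divide_right_mono)
qed

lemma IB_achieved:
  assumes \<tau>: "0 \<le> \<tau>" "\<tau> \<le> 1" and u: "0 \<le> u" "u \<le> 1"
  obtains A and V :: "'x \<Rightarrow> nat pmf" where "finite A" "\<And>x. set_pmf (V x) \<subseteq> A"
    "pmf_mutual_information b (markov_joint (pmf_of_set UNIV) W V) (\<lambda>(y, x, t). x) (\<lambda>(y, x, t). t)
      = \<tau> * D u / ln b"
    "pmf_mutual_information b (markov_joint (pmf_of_set UNIV) W V) (\<lambda>(y, x, t). y) (\<lambda>(y, x, t). t)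
      = \<tau> * D (\<beta> * u) / ln b"
proof -
  obtain e :: "'x \<Rightarrow> nat" where e: "inj e"
    using finite_imp_inj_to_nat_seg[of "UNIV :: 'x set"] by auto
  obtain N :: nat where N: "N \<notin> range e"
    using ex_new_if_finite[of "range e"] by auto
  define K :: "'x \<Rightarrow> 'x pmf" where "K = hamming_channel ((1 - u) / (m + 1))"
  have K: "pmf (K x) y = (1 - u) / (m + 1) + (if x = y then u else 0)" for x y
    using hamming_like_channel[OF u] by (simp add: K_def hamming_like_def card)
  define V :: "'x \<Rightarrow> nat pmf" where
    "V x = bind_pmf (bernoulli_pmf \<tau>) (\<lambda>B. if B then map_pmf e (K x) else return_pmf N)" for x
  define A where "A = insert N (range e)"
  define P where "P t = (if t = N then 1 - \<tau> else if t \<in> range e then \<tau> / (m + 1) else 0)" for t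
  define r where "r t x = (if t = N then 1 / (m + 1) else (1 - u) / (m + 1) + (if x = inv e t then u else 0))"
    for t and x :: 'x
  have V_mix: "pmf (V x) t = \<tau> * pmf (map_pmf e (K x)) t + (1 - \<tau>) * (if t = N then 1 else 0)" for x t
    unfolding V_def pmf_bind using \<tau>
    by (subst integral_measure_pmf[of UNIV]) (auto simp: UNIV_bool indicator_def)
  have V: "pmf (V x) t / real CARD('x) = P t * r t x" for x t
  proof -
    consider "t = N" | i where "t = e i" "t \<noteq> N" | "t \<notin> range e" "t \<noteq> N" by blast
    then show ?thesis
    proof cases
      case 1
      then have "pmf (map_pmf e (K x)) t = 0"
        using N by (auto simp: pmf_eq_0_set_pmf)
      with 1 show ?thesis by (simp add: V_mix P_def r_def card)
    next
      case 2
      then have "pmf (map_pmf e (K x)) t = (1 - u) / (m + 1) + (if x = i then u else 0)"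
        using e by (simp add: pmf_map_inj' K)
      with 2 show ?thesis
        using e by (simp add: V_mix P_def r_def card)
    next
      case 3
      then have "pmf (map_pmf e (K x)) t = 0"
        by (auto simp: pmf_eq_0_set_pmf)
      with 3 show ?thesis by (simp add: V_mix P_def)
    qed
  qed
  have "sum (r t) UNIV = 1" for t
    using card m_gt_1 by (cases "t = N") (simp_all add: r_def[abs_def] sum.distrib)
  then have P: "pmf (bind_pmf (pmf_of_set UNIV) V) t = P t" for t
    by (simp add: pmf_bind_finite V flip: sum_distrib_left)
  have sub: "set_pmf (V x) \<subseteq> A" for x
    by (auto simp: V_def A_def split: if_splits)
  have fin: "finite A" by (simp add: A_def)
  have "r N = (\<lambda>x. (1 - 0) / (m + 1) + (if x = undefined then 0 else 0))"
    by (auto simp: r_def)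
  then have rN: "kl_uniform (r N) = D 0" "kl_uniform (hamming_output \<beta> (r N)) = D (\<beta> * 0)"
    by (simp_all only: kl_uniform_two_point hamming_output_two_point)
  have "r (e i) = (\<lambda>x. (1 - u) / (m + 1) + (if x = i then u else 0))" for i
  proof -
    have "e i \<noteq> N" using N by blast
    then show ?thesis using e by (simp add: r_def[abs_def])
  qed
  then have re: "kl_uniform (r (e i)) = D u" "kl_uniform (hamming_output \<beta> (r (e i))) = D (\<beta> * u)" for i
    by (simp_all only: kl_uniform_two_point hamming_output_two_point)
  have total: "(\<Sum>t\<in>A. P t * f t) = \<tau> * d" if "f N = 0" "\<And>i. f (e i) = d" for f :: "nat \<Rightarrow> real" and d
  proof -
    have "(\<Sum>t\<in>A. P t * f t) = (\<Sum>t\<in>range e. P t * f t)"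
      unfolding A_def using N that by (subst sum.insert) auto
    also have "\<dots> = (\<Sum>i\<in>UNIV. P (e i) * f (e i))"
      using e by (simp add: sum.reindex)
    also have "\<dots> = (\<Sum>i\<in>(UNIV :: 'x set). \<tau> / (m + 1) * d)"
      using N that by (intro sum.cong) (auto simp: P_def)
    also have "\<dots> = \<tau> * d"
      using card m_gt_1 by simp
    finally show ?thesis .
  qed
  show ?thesis
    by (rule that[where V = V, OF fin sub])
       (simp_all add: mutual_information_markov_joint[OF b fin sub W V P] total rN re)
qed

lemma IB_upper_bound:
  fixes V :: "'x \<Rightarrow> nat pmf"
  assumes A: "finite A" "\<And>x. set_pmf (V x) \<subseteq> A"
    and s: "0 \<le> s" and line: "\<And>u. 0 \<le> u \<Longrightarrow> u \<le> 1 \<Longrightarrow> D (\<beta> * u) \<le> c + s * D u"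
    and R: "pmf_mutual_information b (markov_joint (pmf_of_set UNIV) W V) (\<lambda>(y, x, t). x) (\<lambda>(y, x, t). t) \<le> R"
  shows "pmf_mutual_information b (markov_joint (pmf_of_set UNIV) W V) (\<lambda>(y, x, t). y) (\<lambda>(y, x, t). t)
    \<le> c / ln b + s * R"
proof -
  define P where "P t = pmf (bind_pmf (pmf_of_set UNIV) V) t" for t
  define r where "r t x = pmf (V x) t / (real CARD('x) * P t)" for t x
  have P_eq: "P t = (\<Sum>x\<in>UNIV. pmf (V x) t / real CARD('x))" for t
    by (simp add: P_def pmf_bind_finite)
  have V: "pmf (V x) t / real CARD('x) = P t * r t x" for x t
  proof (cases "P t = 0")
    case True
    then have "pmf (V x) t / real CARD('x) = 0"
      unfolding P_eq by (subst (asm) sum_nonneg_eq_0_iff) auto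
    with True show ?thesis by simp
  qed (simp add: r_def)
  have r: "sum (r t) UNIV = 1" if "P t \<noteq> 0" for t
  proof -
    have "P t * sum (r t) UNIV = P t * 1"
      by (simp only: sum_distrib_left V[symmetric] P_eq[symmetric])
    with that show ?thesis by simp
  qed
  have "P t * kl_uniform (hamming_output \<beta> (r t)) \<le> P t * (c + s * kl_uniform (r t))" for t
  proof (cases "P t = 0")
    case False
    have nn: "0 \<le> r t i" for i by (simp add: r_def P_def)
    obtain u where "0 \<le> u" "u \<le> 1" "kl_uniform (r t) = D u"
      using kl_uniform_eq_D[of "r t"] nn r[OF False] by blast
    then show ?thesis
      using kl_uniform_hamming_output[of "r t" u] line[of u] nn r[OF False]
      by (intro mult_left_mono) (auto simp: P_def)
  qed simp
  then have "(\<Sum>t\<in>A. P t * kl_uniform (hamming_output \<beta> (r t)))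
      \<le> (\<Sum>t\<in>A. P t * (c + s * kl_uniform (r t)))"
    by (rule sum_mono)
  also have "\<dots> = c * sum P A + s * (\<Sum>t\<in>A. P t * kl_uniform (r t))"
    by (simp add: sum.distrib sum_distrib_left algebra_simps)
  also have "sum P A = 1"
    unfolding P_def by (rule sum_pmf_eq_1) (use A in auto)
  finally have "(\<Sum>t\<in>A. P t * kl_uniform (hamming_output \<beta> (r t))) / ln b
      \<le> (c + s * (\<Sum>t\<in>A. P t * kl_uniform (r t))) / ln b"
    using b by (intro divide_right_mono) auto
  also have "\<dots> = c / ln b + s * ((\<Sum>t\<in>A. P t * kl_uniform (r t)) / ln b)"
    by (simp add: add_divide_distrib)
  also have "\<dots> \<le> c / ln b + s * R"
    using R s unfolding mutual_information_markov_joint(2)[OF b A W V P_def[symmetric]]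
    by (intro add_left_mono mult_left_mono)
  finally show ?thesis
    unfolding mutual_information_markov_joint(1)[OF b A W V P_def[symmetric]] .
qed

lemma IB_eqI:
  assumes \<tau>: "0 \<le> \<tau>" "\<tau> \<le> 1" and u: "0 \<le> u" "u \<le> 1"
    and s: "0 \<le> s" and line: "\<And>v. 0 \<le> v \<Longrightarrow> v \<le> 1 \<Longrightarrow> D (\<beta> * v) \<le> c + s * D v"
    and R: "R = \<tau> * D u / ln b" and v: "v = \<tau> * D (\<beta> * u) / ln b" "v = c / ln b + s * R"
  shows "IB b R (pmf_of_set UNIV) W = v"
  unfolding IB_def
proof (rule Greatest_equality)
  obtain A and V :: "'x \<Rightarrow> nat pmf" where AV: "finite A" "\<And>x. set_pmf (V x) \<subseteq> A"
    "pmf_mutual_information b (markov_joint (pmf_of_set UNIV) W V) (\<lambda>(y, x, t). x) (\<lambda>(y, x, t). t) = R"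
    "pmf_mutual_information b (markov_joint (pmf_of_set UNIV) W V) (\<lambda>(y, x, t). y) (\<lambda>(y, x, t). t) = v"
    using IB_achieved[OF \<tau> u] unfolding R v(1) by metis
  show "\<exists>(A :: nat set) (V :: 'x \<Rightarrow> nat pmf). finite A \<and> (\<forall>x. set_pmf (V x) \<subseteq> A) \<and>
      pmf_mutual_information b (markov_joint (pmf_of_set UNIV) W V) (\<lambda>(y, x, t). x) (\<lambda>(y, x, t). t) \<le> R \<and>
      v = pmf_mutual_information b (markov_joint (pmf_of_set UNIV) W V) (\<lambda>(y, x, t). y) (\<lambda>(y, x, t). t)"
    by (rule exI[of _ A], rule exI[of _ V]) (use AV in auto)
next
  fix v'
  assume "\<exists>(A :: nat set) (V :: 'x \<Rightarrow> nat pmf). finite A \<and> (\<forall>x. set_pmf (V x) \<subseteq> A) \<and>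
      pmf_mutual_information b (markov_joint (pmf_of_set UNIV) W V) (\<lambda>(y, x, t). x) (\<lambda>(y, x, t). t) \<le> R \<and>
      v' = pmf_mutual_information b (markov_joint (pmf_of_set UNIV) W V) (\<lambda>(y, x, t). y) (\<lambda>(y, x, t). t)"
  then show "v' \<le> v"
    unfolding v(2) using IB_upper_bound[OF _ _ s line] by blast
qed

lemma D_surj:
  assumes "0 \<le> R" "R \<le> ln (m + 1)"
  obtains u where "0 \<le> u" "u \<le> 1" "D u = R"
proof -
  have "\<exists>u\<ge>0. u \<le> 1 \<and> D u = R"
    by (rule IVT') (use assms continuous_on_D D_1 in auto)
  then show ?thesis using that by blast
qed

lemma phi_has_derivative:
  assumes u: "0 < u" "u < 1"
  shows "(phi b W has_real_derivative slope u) (at (D u / ln b))"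
proof -
  define U where "U = inv_into {0..1} D"
  have inj: "inj_on D {0..1}"
    by (rule strict_mono_on_imp_inj_on) (auto simp: strict_mono_on_def intro: D_strict_mono)
  have U: "U (D v) = v" if "0 \<le> v" "v \<le> 1" for v
    using that inj by (simp add: U_def)
  have Dr: "D v \<in> {0<..<ln (m + 1)}" if "0 < v" "v < 1" for v
    using D_pos[of v] D_strict_mono[of v 1] that by (simp add: D_1)
  have img: "D ` {0..1} = {0..ln (m + 1)}"
    using D_mono[of 0] D_mono[of _ 1] D_surj by (force simp: D_1)
  have "continuous_on {0..ln (m + 1)} U"
    unfolding img[symmetric] by (rule continuous_on_inv) (use U continuous_on_D in auto)
  then have contU: "isCont U (D u)"
    using Dr[OF u] by (intro continuous_on_interior) auto
  have nz: "m / (m + 1) * L u \<noteq> 0"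
    using L_pos[OF u] m_gt_1 by simp
  have derivU: "DERIV U (D u) :> inverse (m / (m + 1) * L u)"
  proof (rule DERIV_inverse_function[where f = D and a = 0 and b = "ln (m + 1)"])
    show "DERIV D (U (D u)) :> m / (m + 1) * L u"
      using DERIV_D[of u] u U[of u] unscaled_range[of u] by simp
    show "D (U y) = y" if "0 < y" "y < ln (m + 1)" for y
      using that img unfolding U_def by (intro f_inv_into_f) auto
  qed (use nz Dr[OF u] contU in auto)
  have lnb: "0 < ln b" using b by simp
  have "DERIV (\<lambda>R. D (\<beta> * U (R * ln b)) / ln b) (D u / ln b) :> slope u"
  proof -
    have "DERIV (\<lambda>R. U (R * ln b)) (D u / ln b) :> inverse (m / (m + 1) * L u) * ln b"
      by (rule DERIV_chain2[of U]) (use derivU lnb in \<open>auto intro!: derivative_eq_intros\<close>)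
    then have "DERIV (\<lambda>R. D (\<beta> * U (R * ln b))) (D u / ln b)
        :> slope u * (m / (m + 1) * L u) * (inverse (m / (m + 1) * L u) * ln b)"
      by (rule DERIV_chain2[of "\<lambda>v. D (\<beta> * v)", rotated])
         (use DERIV_D_scaled'[OF u] U[of u] u lnb in simp)
    from DERIV_cdivide[OF this, of "ln b"] show ?thesis
    proof (rule DERIV_cong)
      have cancel: "s * k * (inverse k * c) / c = s" if "k \<noteq> 0" "c \<noteq> 0" for s k c :: real
        using that by simp
      show "slope u * (m / (m + 1) * L u) * (inverse (m / (m + 1) * L u) * ln b) / ln b = slope u"
        by (rule cancel[OF nz]) (use lnb in simp)
    qed
  qed
  then show ?thesis
  proof (rule has_field_derivative_transform_within_open)
    show "D u / ln b \<in> {0<..<ln (m + 1) / ln b}"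
      using Dr[OF u] lnb by (auto simp: divide_strict_right_mono)
    fix R assume R: "R \<in> {0<..<ln (m + 1) / ln b}"
    then obtain v where v: "0 \<le> v" "v \<le> 1" "D v = R * ln b"
      using D_surj[of "R * ln b"] lnb by (auto simp: field_simps)
    then show "D (\<beta> * U (R * ln b)) / ln b = phi b W R"
      using phi_eq[OF v(1,2), unfolded v(3)] U[OF v(1,2), unfolded v(3)] lnb by simp
  qed simp
qed

lemma critical_rate_iff: "critical_rate b W R \<longleftrightarrow> R = D crit / ln b"
proof -
  have lnb: "0 < ln b" using b by simp
  have iff: "critical_rate b W (D u / ln b) \<longleftrightarrow> u = crit" if u: "0 < u" "u < 1" for u
  proof -
    have "D u / ln b \<in> {0<..<log b (real CARD('x))}"
      using D_pos[of u] D_strict_mono[of u 1] u lnb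
      by (auto simp: card log_def D_1 divide_strict_right_mono)
    then have "critical_rate b W (D u / ln b) \<longleftrightarrow> slope u = D (\<beta> * u) / ln b / (D u / ln b)"
      using phi_has_derivative[OF u] u
      by (auto simp: critical_rate_def phi_eq dest: DERIV_unique)
    also have "\<dots> \<longleftrightarrow> N u = 0"
      using lnb D_pos[of u] u by (auto simp: N_def field_simps)
    also have "\<dots> \<longleftrightarrow> u = crit"
      using ex1_critical crit u by blast
    finally show ?thesis .
  qed
  show ?thesis
  proof
    assume R: "critical_rate b W R"
    then have "0 < R * ln b" "R * ln b < ln (m + 1)"
      using lnb by (auto simp: critical_rate_def card log_def field_simps)
    then obtain u where u: "0 \<le> u" "u \<le> 1" "D u = R * ln b"
      using D_surj[of "R * ln b"] by auto
    then have "u \<noteq> 0" "u \<noteq> 1"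
      using \<open>0 < R * ln b\<close> \<open>R * ln b < ln (m + 1)\<close> by (auto simp: D_1)
    moreover have "R = D u / ln b" using u lnb by simp
    ultimately show "R = D crit / ln b"
      using iff[of u] R u by auto
  qed (use iff[of crit] crit in auto)
qed

lemma IB_below_critical:
  assumes R: "0 \<le> R" "R \<le> D crit / ln b"
  shows "IB b R (pmf_of_set UNIV) W = phi b W (D crit / ln b) / (D crit / ln b) * R"
proof -
  define \<tau> where "\<tau> = R * ln b / D crit"
  have lnb: "0 < ln b" using b by simp
  have D: "0 < D crit" using D_pos crit by simp
  have phi: "phi b W (D crit / ln b) / (D crit / ln b) = slope crit"
    using crit lnb by (subst phi_eq) (auto simp: slope_crit)
  show ?thesis
    unfolding phi
  proof (rule IB_eqI[where \<tau> = \<tau> and u = crit and s = "slope crit" and c = 0])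
    show "0 \<le> \<tau>" "\<tau> \<le> 1" "R = \<tau> * D crit / ln b"
      using R D lnb by (auto simp: \<tau>_def field_simps)
    show "slope crit * R = \<tau> * D (\<beta> * crit) / ln b"
      using D lnb by (simp add: \<tau>_def slope_crit)
  qed (use crit chord_bound slope_pos[of crit] in auto)
qed

lemma IB_above_critical:
  assumes R: "D crit / ln b < R" "R \<le> log b (m + 1)"
  shows "IB b R (pmf_of_set UNIV) W = phi b W R"
proof -
  have lnb: "0 < ln b" using b by simp
  have "0 < D crit" using D_pos crit by simp
  have R': "D crit < R * ln b" "R * ln b \<le> ln (m + 1)"
    using R lnb by (auto simp: log_def field_simps)
  then obtain u where u: "0 \<le> u" "u \<le> 1" "D u = R * ln b"
    using D_surj[of "R * ln b"] \<open>0 < D crit\<close> by auto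
  have "crit \<le> u"
    using D_mono[of u crit] u crit R' by force
  obtain s where s: "0 \<le> s"
      "\<And>v. 0 \<le> v \<Longrightarrow> v \<le> 1 \<Longrightarrow> D (\<beta> * v) \<le> D (\<beta> * u) + s * (D v - D u)"
    using supporting_line[OF \<open>crit \<le> u\<close> u(2)] by blast
  have R_eq: "R = D u / ln b" using u lnb by simp
  have phi: "phi b W R = D (\<beta> * u) / ln b"
    unfolding R_eq using u by (rule_tac phi_eq)
  show ?thesis
    unfolding phi
  proof (rule IB_eqI[where \<tau> = 1 and u = u and s = s and c = "D (\<beta> * u) - s * D u"])
    show "D (\<beta> * v) \<le> D (\<beta> * u) - s * D u + s * D v" if "0 \<le> v" "v \<le> 1" for v
      using s(2)[OF that] by (simp add: algebra_simps)
    show "D (\<beta> * u) / ln b = (D (\<beta> * u) - s * D u) / ln b + s * R"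
      using lnb by (simp add: R_eq diff_divide_distrib)
  qed (use u s R_eq in auto)
qed

end

end

theorem corollary1:
  fixes b \<alpha> :: real and n :: nat
    and W :: "'x::finite \<Rightarrow> 'x pmf"
  assumes "b > 1"
    and "n \<ge> 3"
    and "CARD('x) = n"
    and "\<alpha> \<in> {0<..<1 / real n} \<union> {1 / real n<..<1 / (real n - 1)}"
    and "W = hamming_channel \<alpha>"
  shows "(\<exists>!Rc. critical_rate b W Rc) \<and>
    (\<forall>Rc. critical_rate b W Rc \<longrightarrow>
      (\<forall>R\<in>{0..log b (real n)}.
        IB b R (pmf_of_set UNIV) W =
          (if R \<le> Rc then phi b W Rc / Rc * R else phi b W R)))"
proof -
  define m where "m = real n - 1"
  define \<beta> where "\<beta> = 1 - real n * \<alpha>"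
  have m: "1 < m" "real CARD('x) = m + 1" using assms(2,3) by (auto simp: m_def)
  have \<alpha>: "0 < \<alpha>" "\<alpha> \<noteq> 1 / real n" "m * \<alpha> < 1" "real n * \<alpha> \<noteq> 1"
    using assms(2,4) m by (auto simp: m_def field_simps)
  have "m * (real n * \<alpha>) < real n"
    using \<alpha>(3) assms(2) mult_strict_left_mono[of "m * \<alpha>" 1 "real n"] by (simp add: algebra_simps)
  then interpret symmetric_channel m \<beta>
    using m \<alpha> by unfold_locales (auto simp: \<beta>_def m_def algebra_simps)
  have "(1 - \<beta>) / real CARD('x) = \<alpha>"
    using assms(2,3) by (simp add: \<beta>_def)
  then have W: "hamming_like \<beta> W"
    using hamming_like_hamming_channel[where 'x = 'x, of \<beta>] \<beta>_gt \<beta>_less m assms(5)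
    by simp
  note channel = m(2) W assms(1)
  have n: "real n = m + 1" by (simp add: m_def)
  show ?thesis
    unfolding n using critical_rate_iff[OF channel] IB_below_critical[OF channel]
      IB_above_critical[OF channel] by auto
qed

end
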